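(* Let $N\ge 2$, and let $1<p<\frac{N+1}{N-3}$ if $N>3$ and $p>1$ if $2\le N\le 3$. Write $x=(x',x_N)\in\mathbb{R}^{N-1}\times\mathbb{R}$. Let $u>0$ be a bounded solution to $-\Delta u+u=u^p$ in $\mathbb{R}^N$ such that $u(x',x_N)\to 0$ as $|x_N|\to\infty$, uniformly in $x'$. Assume that $\nabla_{x'}u(x',x_N)\to 0$ as $|x'|\to\infty$, for any $x_N$. Then $$\|u\|_{\infty}\ge\left(\frac{p+1}{2}\right)^{\frac{1}{p-1}}.$$
   Context: Solutions are classical ($C^2$). $\nabla_{x'}$ denotes the gradient with respect to the first $N-1$ variables, and $\|\cdot\|_\infty$ is the $L^\infty(\mathbb{R}^N)$ norm. *)

theory Defs
  imports "HOL-Analysis.Analysis" "HOL-Probability.Essential_Supremum"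
begin

text \<open>
  The space \<open>(real ^ 'm) \<times> real\<close> plays the role of \<open>R^{N-1} \<times> R\<close>, with \<open>N = CARD('m) + 1\<close>. Its
  library norm, measure and \<^const>\<open>Basis\<close> are those of \<open>R^N\<close>, so that everything below can be
  stated for an arbitrary Euclidean space.
\<close>

text \<open>
  Meaningful only where \<open>f\<close> is differentiable: elsewhere \<^const>\<open>frechet_derivative\<close> is an
  unspecified function.
\<close>

definition partial_deriv :: "'a::euclidean_space \<Rightarrow> ('a \<Rightarrow> real) \<Rightarrow> 'a \<Rightarrow> real" where
  "partial_deriv b f x = frechet_derivative f (at x) b"

definition gradient :: "('a::euclidean_space \<Rightarrow> real) \<Rightarrow> 'a \<Rightarrow> 'a" where
  "gradient f x = (\<Sum>b\<in>Basis. partial_deriv b f x *\<^sub>R b)"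

definition laplacian :: "('a::euclidean_space \<Rightarrow> real) \<Rightarrow> 'a \<Rightarrow> real" where
  "laplacian f x = (\<Sum>b\<in>Basis. partial_deriv b (partial_deriv b f) x)"

definition C1 :: "('a::euclidean_space \<Rightarrow> real) \<Rightarrow> bool" where
  "C1 f \<longleftrightarrow> (\<forall>x. f differentiable (at x)) \<and> (\<forall>b\<in>Basis. continuous_on UNIV (partial_deriv b f))"

definition C2 :: "('a::euclidean_space \<Rightarrow> real) \<Rightarrow> bool" where
  "C2 f \<longleftrightarrow> C1 f \<and> (\<forall>b\<in>Basis. C1 (partial_deriv b f))"

text \<open>
  The power \<open>u^p\<close> has a real exponent; it is only used for positive \<open>u\<close>, where \<open>powr\<close> is the
  usual real power.
\<close>

definition classical_solution :: "real \<Rightarrow> ('a::euclidean_space \<Rightarrow> real) \<Rightarrow> bool" where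
  "classical_solution p u \<longleftrightarrow> C2 u \<and> (\<forall>x. - laplacian u x + u x = u x powr p)"

definition gradient_fst ::
  "('a::euclidean_space \<times> 'b \<Rightarrow> real) \<Rightarrow> 'a \<times> 'b \<Rightarrow> 'a" where
  "gradient_fst f = (\<lambda>(x, t). gradient (\<lambda>y. f (y, t)) x)"

text \<open>
  Extended-real valued, since \<^const>\<open>esssup\<close> lives on complete linear orders.
\<close>

definition Linf_norm :: "('a::euclidean_space \<Rightarrow> real) \<Rightarrow> ereal" where
  "Linf_norm f = esssup lebesgue (\<lambda>x. ereal \<bar>f x\<bar>)"

end

theory Submission
  imports Defs "HOL-Probability.Sinc_Integral"
begin

text \<open>
  Suppose \<open>u \<le> m\<close> with \<open>m\<close> below the bound, so that \<open>F(s) = s\<^sup>2 / 2 - s\<^bsup>p+1\<^esup> / (p + 1)\<close> dominates a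
  positive multiple of \<open>s\<^sup>2\<close> on the range of \<open>u\<close>. By an interior gradient estimate, the
  derivatives \<open>\<partial>\<^sub>e\<partial>\<^sub>b u\<close> are controlled locally by \<open>\<partial>\<^sub>e u\<close>, so the second derivatives in
  \<open>x'\<close> tend to \<open>0\<close> as \<open>|x'|\<close> grows. There each vertical line almost carries a solution of the
  one-dimensional equation with zero energy, whose maximum would have to be a zero of \<open>F\<close>;
  hence \<open>u\<close> tends to \<open>0\<close> at infinity. Then \<open>u\<close> and its derivatives decay faster than any
  power, and Pohozaev's identity \<open>(N - 2) / 2 \<integral> |\<nabla>u|\<^sup>2 + N \<integral> F(u) = 0\<close> contradicts \<open>F(u) > 0\<close>.
\<close>

section \<open>Directional derivatives and an interior gradient estimate\<close>

text \<open>The number in the theorem is the positive zero of \<open>F\<close>, since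
  \<open>F(s) = s^2 (1/2 - s^(p-1)/(p+1))\<close> for positive \<open>s\<close>. Two obstacles shape
  the argument. First, \<open>u\<close> is only C2, so the equation cannot simply be differentiated.
  Second derivatives are instead bounded by applying to differences of translates of
  \<open>u\<close> a gradient estimate that rests on the maximum principle alone. That principle
  looks at a function only along lines, hence the relation \<open>has_dir_deriv\<close> between a
  function and a candidate derivative. The resulting bounds are linear in the supremum over a nearby
  ball, so smallness and decay pass from \<open>u\<close> to its derivatives. Second, the gradient
  hypothesis is pointwise in x_N, but it is needed uniformly on bounded vertical segments; a
  Lipschitz bound in x_N and a finite net close this gap. Fast decay is required because the vector
  field behind Pohozaev's identity carries a factor x. Rational barriers give enough decay and are
  also the integrable majorants.\<close>

definition has_dir_deriv :: "'a::real_normed_vector \<Rightarrow> ('a \<Rightarrow> real) \<Rightarrow> ('a \<Rightarrow> real) \<Rightarrow> bool" where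
  "has_dir_deriv b f f' \<longleftrightarrow> (\<forall>y. ((\<lambda>t. f (y + t *\<^sub>R b)) has_real_derivative f' y) (at 0))"

lemma has_dir_derivD:
  assumes "has_dir_deriv b f f'"
  shows "((\<lambda>t. f (y + t *\<^sub>R b)) has_real_derivative f' (y + s *\<^sub>R b)) (at s)"
proof -
  have "((\<lambda>t. f ((y + s *\<^sub>R b) + t *\<^sub>R b)) has_real_derivative f' (y + s *\<^sub>R b)) (at 0)"
    using assms unfolding has_dir_deriv_def by blast
  moreover have "(\<lambda>t. f ((y + s *\<^sub>R b) + t *\<^sub>R b)) = (\<lambda>t. f (y + (t + s) *\<^sub>R b))"
    by (simp add: algebra_simps)
  ultimately show ?thesis
    using DERIV_shift[of "\<lambda>t. f (y + t *\<^sub>R b)" "f' (y + s *\<^sub>R b)" 0 s] by simp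
qed

lemma has_dir_deriv_neg:
  assumes "has_dir_deriv b f f'"
  shows "((\<lambda>t. f (y + t *\<^sub>R (- b))) has_real_derivative - f' (y + s *\<^sub>R (- b))) (at s)"
proof -
  have "((\<lambda>t. f (y + t *\<^sub>R b)) has_real_derivative f' (y + (- s) *\<^sub>R b)) (at (- s))"
    by (rule has_dir_derivD[OF assms])
  from DERIV_mirror[THEN iffD1, OF this] show ?thesis by simp
qed

text \<open>If \<open>q\<close> were positive, \<open>f1\<close>, which vanishes at 0, would be
  positive just to the right of 0, and \<open>f\<close> would increase there. Continuity of the
  second derivative is not involved.\<close>

lemma second_derivative_le_0_at_local_max:
  fixes f :: "real \<Rightarrow> real"
  assumes d1: "\<And>t. (f has_real_derivative f1 t) (at t)"
    and d2: "(f1 has_real_derivative q) (at 0)"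
    and del: "\<delta> > 0" and mx: "\<And>t. \<bar>t\<bar> < \<delta> \<Longrightarrow> f t \<le> f 0"
  shows "q \<le> 0"
proof (rule ccontr)
  assume "\<not> q \<le> 0"
  then have q: "q > 0" by simp
  have z: "f1 0 = 0"
    by (rule DERIV_local_max[OF d1 del]) (use mx in auto)
  obtain d where d: "d > 0" "\<And>h. 0 < h \<Longrightarrow> h < d \<Longrightarrow> f1 0 < f1 (0 + h)"
    using DERIV_pos_inc_right[OF d2 q] by auto
  define h where "h = min d \<delta> / 2"
  have h: "0 < h" "h < d" "h < \<delta>" using d del by (auto simp: h_def)
  obtain z' where z': "0 < z'" "z' < h" "f h - f 0 = (h - 0) * f1 z'"
    using MVT2[of 0 h f f1] d1 h by auto
  have "f1 z' > 0" using d(2)[of z'] z' h z by auto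
  then have "f h > f 0" using z' h by (smt (verit) mult_pos_pos)
  with mx[of h] h show False by auto
qed

text \<open>The odd part of \<open>w\<close> under the reflection \<open>\<sigma>\<close> in the hyperplane through \<open>x\<close> orthogonal to \<open>e\<close>
  vanishes on that hyperplane, so on a half ball it lies below the quadratic barrier \<open>\<psi>\<close>; the slope
  of \<open>\<psi>\<close> at the centre is the bound.\<close>

lemma gradient_estimate_upper:
  fixes w :: "'a::euclidean_space \<Rightarrow> real" and w1 w2 :: "'a \<Rightarrow> 'a \<Rightarrow> real" and A B :: real
  assumes e: "e \<in> Basis" and cont: "continuous_on UNIV w"
    and w1: "\<And>b. b \<in> Basis \<Longrightarrow> has_dir_deriv b w (w1 b)"
    and w2: "\<And>b. b \<in> Basis \<Longrightarrow> has_dir_deriv b (w1 b) (w2 b)"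
    and A: "\<And>y. y \<in> cball x 1 \<Longrightarrow> \<bar>w y\<bar> \<le> A"
    and B: "\<And>y. y \<in> cball x 1 \<Longrightarrow> \<bar>\<Sum>b\<in>Basis. w2 b y\<bar> \<le> B"
    and "B > 0"
  shows "w1 e x \<le> DIM('a) * A + B"
proof -
  \<comment> \<open>Chosen so that the Laplacian of \<open>\<psi>\<close> below,
    \<open>2 * DIM('a) * A - 2 * L\<close>, equals \<open>- 2 * B\<close>, while the odd part of
    \<open>w\<close> has Laplacian at least \<open>- B\<close>: \<open>g\<close> is strictly
    subharmonic and has no interior maximum.\<close>
  define L where "L = DIM('a) * A + B"
  have A0: "A \<ge> 0" using A[of x] by auto
  then have L0: "L > 0" using \<open>B > 0\<close> by (simp add: L_def add_nonneg_pos)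
  define \<sigma> :: "'a \<Rightarrow> 'a" where "\<sigma> z = z - (2 * (z \<bullet> e)) *\<^sub>R e" for z
  have ee: "e \<bullet> e = 1" using e by simp
  have sig_norm: "norm (\<sigma> z) = norm z" for z
  proof -
    have "\<sigma> z \<bullet> \<sigma> z = z \<bullet> z"
      unfolding \<sigma>_def by (simp add: inner_diff_left inner_diff_right ee inner_commute algebra_simps)
    then show ?thesis by (simp add: norm_eq_sqrt_inner)
  qed
  have sig_line: "\<sigma> (z + t *\<^sub>R b) = \<sigma> z + t *\<^sub>R \<sigma> b" for z b t
    unfolding \<sigma>_def by (simp add: inner_add_left algebra_simps)
  \<comment> \<open>On the half ball \<open>0 \<le> z \<bullet> e \<le> 1\<close>, so the last two
    terms together are nonnegative. Hence \<open>\<psi>\<close> is at least \<open>A\<close> on the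
    round part of the boundary, where it beats the odd part, and nonnegative on the flat part, where
    the odd part is 0.\<close>
  define \<psi> where "\<psi> z = A * (z \<bullet> z) + L * (z \<bullet> e) - L * (z \<bullet> e)^2" for z
  define g where "g z = (w (x + z) - w (x + \<sigma> z)) / 2 - \<psi> z" for z
  define H where "H = cball 0 1 \<inter> {z. z \<bullet> e \<ge> 0}"
  have "compact H" unfolding H_def
    by (intro compact_Int_closed compact_cball closed_Collect_le continuous_intros)
  moreover have "0 \<in> H" by (simp add: H_def)
  moreover have "continuous_on H g"
    unfolding g_def \<psi>_def \<sigma>_def
    by (intro continuous_intros continuous_on_compose2[OF cont]) auto
  ultimately obtain z0 where z0: "z0 \<in> H" "\<And>z. z \<in> H \<Longrightarrow> g z \<le> g z0"
    using continuous_attains_sup[of H g] by blast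
  have te: "z \<bullet> e \<le> 1" if "z \<in> H" for z
    using Cauchy_Schwarz_ineq2[of z e] e that unfolding H_def by auto
  have inb: "x + z \<in> cball x 1" "x + \<sigma> z \<in> cball x 1" if "norm z \<le> 1" for z
    using that sig_norm[of z] by (auto simp: dist_norm)
  have "g z0 \<le> 0"
  proof (rule ccontr)
    assume pos: "\<not> g z0 \<le> 0"
    have t0: "0 \<le> z0 \<bullet> e" "z0 \<bullet> e \<le> 1" "norm z0 \<le> 1" using z0(1) te by (auto simp: H_def)
    have tq: "(z0 \<bullet> e)^2 \<le> z0 \<bullet> e"
      using t0 by (simp add: power2_eq_square mult_left_le)
    have psi_ge: "\<psi> z0 \<ge> A * (z0 \<bullet> z0)"
      using tq L0 unfolding \<psi>_def by (smt (verit) mult_left_mono)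
    have "z0 \<bullet> e \<noteq> 0"
    proof
      assume "z0 \<bullet> e = 0"
      then have "g z0 = - \<psi> z0" by (simp add: g_def \<sigma>_def)
      moreover have "A * (z0 \<bullet> z0) \<ge> 0" using A0 by simp
      ultimately show False using pos psi_ge by linarith
    qed
    then have tp: "z0 \<bullet> e > 0" using t0 by auto
    have "norm z0 \<noteq> 1"
    proof
      assume "norm z0 = 1"
      then have "z0 \<bullet> z0 = 1" by (simp add: norm_eq_1)
      then have "\<psi> z0 \<ge> A" using psi_ge by simp
      moreover have "\<bar>w (x + z0)\<bar> \<le> A" "\<bar>w (x + \<sigma> z0)\<bar> \<le> A" using A inb t0 by auto
      ultimately show False using pos unfolding g_def by (auto simp: abs_le_iff field_simps)
    qed
    then have nl: "norm z0 < 1" using t0 by auto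
    define \<delta> where "\<delta> = min (z0 \<bullet> e) (1 - norm z0)"
    have del: "\<delta> > 0" using tp nl by (simp add: \<delta>_def)
    have key: "(w2 b (x + z0) - w2 b (x + \<sigma> z0)) / 2 - (2 * A - 2 * L * (b \<bullet> e)^2) \<le> 0"
      if b: "b \<in> Basis" for b
    proof (rule second_derivative_le_0_at_local_max[OF _ _ del])
      \<comment> \<open>On basis vectors \<open>\<sigma>\<close> acts as a sign, which appears once
        in the first derivative and squares to 1 in the second.\<close>
      define \<epsilon> :: real where "\<epsilon> = (if b = e then -1 else 1)"
      have sb: "\<sigma> b = \<epsilon> *\<^sub>R b"
        using b e by (auto simp: \<sigma>_def \<epsilon>_def inner_Basis algebra_simps scaleR_2)
      have ep: "\<epsilon> * \<epsilon> = 1" by (simp add: \<epsilon>_def)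
      have D: "((\<lambda>t. f (x + \<sigma> (z0 + t *\<^sub>R b))) has_real_derivative \<epsilon> * f' (x + \<sigma> (z0 + t *\<^sub>R b))) (at t)"
        if "has_dir_deriv b f f'" for f f' t
        using has_dir_derivD[OF that, of "x + \<sigma> z0"] has_dir_deriv_neg[OF that, of "x + \<sigma> z0"]
        unfolding sig_line sb by (auto simp: \<epsilon>_def add.assoc[symmetric] add_diff_eq)
      have D': "((\<lambda>t. f (x + (z0 + t *\<^sub>R b))) has_real_derivative f' (x + (z0 + t *\<^sub>R b))) (at t)"
        if "has_dir_deriv b f f'" for f f' t
        using has_dir_derivD[OF that, of "x + z0"] by (simp add: add.assoc)
      have psi: "\<psi> (z0 + t *\<^sub>R b) = A * (z0 \<bullet> z0 + 2 * t * (z0 \<bullet> b) + t^2) +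
          L * (z0 \<bullet> e + t * (b \<bullet> e)) - L * (z0 \<bullet> e + t * (b \<bullet> e))^2" for t
        using b by (simp add: \<psi>_def inner_add_left inner_add_right inner_commute power2_eq_square algebra_simps)
      show "((\<lambda>t. g (z0 + t *\<^sub>R b)) has_real_derivative
          (w1 b (x + (z0 + t *\<^sub>R b)) - \<epsilon> * w1 b (x + \<sigma> (z0 + t *\<^sub>R b))) / 2 -
          (A * (2 * (z0 \<bullet> b) + 2 * t) + L * (b \<bullet> e) - 2 * L * (z0 \<bullet> e + t * (b \<bullet> e)) * (b \<bullet> e))) (at t)" for t
        unfolding g_def psi
        by (rule derivative_eq_intros D[OF w1[OF b]] D'[OF w1[OF b]] refl | simp)+
      have "((\<lambda>t. (w1 b (x + (z0 + t *\<^sub>R b)) - \<epsilon> * w1 b (x + \<sigma> (z0 + t *\<^sub>R b))) / 2 -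
          (A * (2 * (z0 \<bullet> b) + 2 * t) + L * (b \<bullet> e) - 2 * L * (z0 \<bullet> e + t * (b \<bullet> e)) * (b \<bullet> e)))
         has_real_derivative
          (w2 b (x + (z0 + 0 *\<^sub>R b)) - \<epsilon> * (\<epsilon> * w2 b (x + \<sigma> (z0 + 0 *\<^sub>R b)))) / 2
          - (2 * A - 2 * L * (b \<bullet> e)^2)) (at 0)"
        by (rule derivative_eq_intros D[OF w2[OF b]] D'[OF w2[OF b]] refl | simp)+
           (simp add: field_simps power2_eq_square)
      then show "((\<lambda>t. (w1 b (x + (z0 + t *\<^sub>R b)) - \<epsilon> * w1 b (x + \<sigma> (z0 + t *\<^sub>R b))) / 2 -
          (A * (2 * (z0 \<bullet> b) + 2 * t) + L * (b \<bullet> e) - 2 * L * (z0 \<bullet> e + t * (b \<bullet> e)) * (b \<bullet> e)))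
         has_real_derivative
          (w2 b (x + z0) - w2 b (x + \<sigma> z0)) / 2 - (2 * A - 2 * L * (b \<bullet> e)^2)) (at 0)"
        using ep by (simp flip: mult.assoc)
      show "g (z0 + t *\<^sub>R b) \<le> g (z0 + 0 *\<^sub>R b)" if t: "\<bar>t\<bar> < \<delta>" for t
      proof -
        have "norm (z0 + t *\<^sub>R b) \<le> norm z0 + \<bar>t\<bar>"
          using norm_triangle_ineq[of z0 "t *\<^sub>R b"] b by simp
        moreover have "\<bar>t * (b \<bullet> e)\<bar> \<le> \<bar>t\<bar>" using b e by (simp add: inner_Basis)
        ultimately have "z0 + t *\<^sub>R b \<in> H" using t by (auto simp: H_def \<delta>_def inner_add_left)
        then show ?thesis using z0(2) by simp
      qed
    qed
    have "(\<Sum>b\<in>Basis. (w2 b (x + z0) - w2 b (x + \<sigma> z0)) / 2 - (2 * A - 2 * L * (b \<bullet> e)^2)) \<le> 0"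
      by (rule sum_nonpos) (use key in auto)
    moreover have "(\<Sum>b\<in>Basis. (b \<bullet> e)^2) = (1::real)"
      using e euclidean_inner[of e e] by (simp add: power2_eq_square inner_commute)
    ultimately have "((\<Sum>b\<in>Basis. w2 b (x + z0)) - (\<Sum>b\<in>Basis. w2 b (x + \<sigma> z0))) / 2
        - (DIM('a) * (2 * A) - 2 * L) \<le> 0"
      by (simp add: sum_subtractf flip: sum_divide_distrib sum_distrib_left)
    moreover have "\<bar>\<Sum>b\<in>Basis. w2 b (x + z0)\<bar> \<le> B" "\<bar>\<Sum>b\<in>Basis. w2 b (x + \<sigma> z0)\<bar> \<le> B"
      using B inb t0 by auto
    ultimately show False using \<open>B > 0\<close> unfolding L_def by (auto simp: abs_le_iff field_simps)
  qed
  have le: "(w (x + t *\<^sub>R e) - w (x + t *\<^sub>R (- e))) / 2 \<le> A * t^2 + L * t - L * t^2"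
    if t: "0 < t" "t < 1" for t
  proof -
    have "t *\<^sub>R e \<in> H" using t e by (simp add: H_def)
    then have "g (t *\<^sub>R e) \<le> 0" using z0(2) \<open>g z0 \<le> 0\<close> order.trans by blast
    moreover have "\<sigma> (t *\<^sub>R e) = t *\<^sub>R (- e)" using ee by (simp add: \<sigma>_def algebra_simps flip: scaleR_2)
    ultimately show ?thesis by (simp add: g_def \<psi>_def ee power2_eq_square)
  qed
  \<comment> \<open>\<open>k\<close> vanishes at 0 and is nonnegative just to the right, so its
    slope \<open>L - w1 e x\<close> at 0 is nonnegative. The two one-sided shifts each contribute
    half of \<open>w1 e x\<close>.\<close>
  define k where "k t = A * t^2 + L * t - L * t^2 - (w (x + t *\<^sub>R e) - w (x + t *\<^sub>R (- e))) / 2" for t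
  have "(k has_real_derivative L - w1 e x) (at 0)"
    unfolding k_def
    using has_dir_derivD[OF w1[OF e], of x 0] has_dir_deriv_neg[OF w1[OF e], of x 0]
    by (auto intro!: derivative_eq_intros)
  moreover have "k 0 = 0" by (simp add: k_def)
  ultimately have lim: "((\<lambda>h. k h / h) \<longlongrightarrow> L - w1 e x) (at_right 0)"
    unfolding DERIV_def by (auto intro: tendsto_mono[OF at_le])
  have "\<forall>\<^sub>F h in at_right 0. 0 \<le> k h / h"
    unfolding eventually_at_right_field
    by (rule exI[of _ 1]) (use le in \<open>auto simp: k_def\<close>)
  then have "0 \<le> L - w1 e x"
    by (rule tendsto_lowerbound[OF lim]) simp
  then show ?thesis by (simp add: L_def)
qed

lemma has_dir_deriv_minus: "has_dir_deriv b f f' \<Longrightarrow> has_dir_deriv b (\<lambda>x. - f x) (\<lambda>x. - f' x)"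
  unfolding has_dir_deriv_def by (auto intro!: derivative_eq_intros)

text \<open>Apply the one-sided bound to \<open>w\<close> and \<open>- w\<close>; enlarging
  \<open>B\<close> by \<open>\<epsilon>\<close> supplies the strict positivity demanded
  there.\<close>

lemma gradient_estimate:
  fixes w :: "'a::euclidean_space \<Rightarrow> real" and w1 w2 :: "'a \<Rightarrow> 'a \<Rightarrow> real" and A B :: real
  assumes e: "e \<in> Basis" and cont: "continuous_on UNIV w"
    and w1: "\<And>b. b \<in> Basis \<Longrightarrow> has_dir_deriv b w (w1 b)"
    and w2: "\<And>b. b \<in> Basis \<Longrightarrow> has_dir_deriv b (w1 b) (w2 b)"
    and A: "\<And>y. y \<in> cball x 1 \<Longrightarrow> \<bar>w y\<bar> \<le> A"
    and B: "\<And>y. y \<in> cball x 1 \<Longrightarrow> \<bar>\<Sum>b\<in>Basis. w2 b y\<bar> \<le> B"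
  shows "\<bar>w1 e x\<bar> \<le> DIM('a) * A + B"
proof (rule field_le_epsilon)
  fix \<epsilon> :: real assume "\<epsilon> > 0"
  have B0: "B \<ge> 0" using B[of x] by auto
  have B': "\<bar>\<Sum>b\<in>Basis. w2 b y\<bar> \<le> B + \<epsilon>" if "y \<in> cball x 1" for y
    using B[OF that] \<open>\<epsilon> > 0\<close> by linarith
  have "w1 e x \<le> DIM('a) * A + (B + \<epsilon>)"
    by (rule gradient_estimate_upper[OF e cont w1 w2 A B']) (use B0 \<open>\<epsilon> > 0\<close> in auto)
  moreover have "- w1 e x \<le> DIM('a) * A + (B + \<epsilon>)"
  proof (rule gradient_estimate_upper[OF e, of "\<lambda>x. - w x" "\<lambda>b x. - w1 b x" "\<lambda>b x. - w2 b x"])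
    show "continuous_on UNIV (\<lambda>x. - w x)" by (intro continuous_intros cont)
  qed (use w1 w2 A B' B0 \<open>\<epsilon> > 0\<close> in \<open>auto intro: has_dir_deriv_minus simp: sum_negf\<close>)
  ultimately show "\<bar>w1 e x\<bar> \<le> DIM('a) * A + B + \<epsilon>" by linarith
qed

section \<open>Partial derivatives along lines and the symmetry of second derivatives\<close>

lemma has_dir_deriv_partial:
  assumes "\<And>x. f differentiable (at x)"
  shows "has_dir_deriv b f (partial_deriv b f)"
  unfolding has_dir_deriv_def
proof
  fix y
  have f: "(f has_derivative frechet_derivative f (at y)) (at y)"
    using assms frechet_derivative_works by blast
  have l: "((\<lambda>t. y + t *\<^sub>R b) has_derivative (\<lambda>t. t *\<^sub>R b)) (at 0)"
    by (auto intro!: derivative_eq_intros)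
  have "((\<lambda>t. f (y + t *\<^sub>R b)) has_derivative (\<lambda>t. frechet_derivative f (at y) (t *\<^sub>R b))) (at 0)"
    using has_derivative_compose[OF l, of f] f by simp
  moreover have "(\<lambda>t. frechet_derivative f (at y) (t *\<^sub>R b)) = (*) (partial_deriv b f y)"
    by (simp add: fun_eq_iff partial_deriv_def linear_cmul[OF linear_frechet_derivative[OF assms]] mult.commute)
  ultimately show "((\<lambda>t. f (y + t *\<^sub>R b)) has_real_derivative partial_deriv b f y) (at 0)"
    by (simp add: has_field_derivative_def)
qed

lemma has_dir_deriv_mvt:
  assumes f: "has_dir_deriv b f f'" and C: "\<And>s. \<bar>s\<bar> \<le> \<bar>t\<bar> \<Longrightarrow> \<bar>f' (x + s *\<^sub>R b)\<bar> \<le> C"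
  shows "\<bar>f (x + t *\<^sub>R b) - f x\<bar> \<le> C * \<bar>t\<bar>"
proof -
  have "norm (f (x + t *\<^sub>R b) - f (x + 0 *\<^sub>R b)) \<le> C * norm (t - 0)"
  proof (rule field_differentiable_bound[of "{- \<bar>t\<bar>..\<bar>t\<bar>}" "\<lambda>t. f (x + t *\<^sub>R b)" "\<lambda>t. f' (x + t *\<^sub>R b)"])
    show "((\<lambda>t. f (x + t *\<^sub>R b)) has_field_derivative f' (x + z *\<^sub>R b)) (at z within {- \<bar>t\<bar>..\<bar>t\<bar>})" for z
      using has_dir_derivD[OF f] has_field_derivative_at_within by blast
  qed (use C in auto)
  then show ?thesis by simp
qed

text \<open>The mean value theorem is used in direction \<open>b\<close> on the increment in
  direction \<open>e\<close>, then in direction \<open>e\<close> on \<open>f1\<close>. The left-hand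
  side is symmetric in \<open>b\<close> and \<open>e\<close>.\<close>

lemma second_difference_mvt:
  assumes f1: "has_dir_deriv b f f1" and f12: "has_dir_deriv e f1 f12" and s: "s > 0"
  obtains \<xi> \<eta> where "0 < \<xi>" "\<xi> < s" "0 < \<eta>" "\<eta> < s"
    "f (x + s *\<^sub>R b + s *\<^sub>R e) - f (x + s *\<^sub>R b) - f (x + s *\<^sub>R e) + f x
       = s\<^sup>2 * f12 (x + \<xi> *\<^sub>R b + \<eta> *\<^sub>R e)"
proof -
  define k where "k t = f (x + s *\<^sub>R e + t *\<^sub>R b) - f (x + t *\<^sub>R b)" for t
  have "(k has_real_derivative f1 (x + s *\<^sub>R e + t *\<^sub>R b) - f1 (x + t *\<^sub>R b)) (at t)" for t
    unfolding k_def by (intro DERIV_diff has_dir_derivD[OF f1])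
  then obtain \<xi> where xi: "0 < \<xi>" "\<xi> < s"
    "k s - k 0 = (s - 0) * (f1 (x + s *\<^sub>R e + \<xi> *\<^sub>R b) - f1 (x + \<xi> *\<^sub>R b))"
    using MVT2[OF s, of k "\<lambda>t. f1 (x + s *\<^sub>R e + t *\<^sub>R b) - f1 (x + t *\<^sub>R b)"] by metis
  obtain \<eta> where eta: "0 < \<eta>" "\<eta> < s"
    "f1 (x + \<xi> *\<^sub>R b + s *\<^sub>R e) - f1 (x + \<xi> *\<^sub>R b + 0 *\<^sub>R e) = (s - 0) * f12 (x + \<xi> *\<^sub>R b + \<eta> *\<^sub>R e)"
    using MVT2[OF s has_dir_derivD[OF f12, of "x + \<xi> *\<^sub>R b"]] by metis
  have comm: "x + s *\<^sub>R e + \<xi> *\<^sub>R b = x + \<xi> *\<^sub>R b + s *\<^sub>R e" "x + s *\<^sub>R e + s *\<^sub>R b = x + s *\<^sub>R b + s *\<^sub>R e"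
    by (simp_all add: algebra_simps)
  have "f (x + s *\<^sub>R b + s *\<^sub>R e) - f (x + s *\<^sub>R b) - f (x + s *\<^sub>R e) + f x = k s - k 0"
    "k s - k 0 = s * (s * f12 (x + \<xi> *\<^sub>R b + \<eta> *\<^sub>R e))"
    using xi(3) eta(3) unfolding k_def comm by simp_all
  then show thesis
    using that[OF xi(1,2) eta(1,2)] by (simp add: power2_eq_square)
qed

text \<open>Schwarz's theorem: the same second difference is expressed through \<open>f12\<close>
  and through \<open>f21\<close>, each at a point that is arbitrarily close to
  \<open>x\<close>.\<close>

lemma mixed_dir_deriv_eq:
  assumes f1: "has_dir_deriv b f f1" and f12: "has_dir_deriv e f1 f12"
    and f2: "has_dir_deriv e f f2" and f21: "has_dir_deriv b f2 f21"
    and c12: "isCont f12 x" and c21: "isCont f21 x"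
  shows "f12 x = f21 x"
proof -
  have "dist (f12 x) (f21 x) \<le> 0"
  proof (rule field_le_epsilon)
    fix \<epsilon> :: real assume "\<epsilon> > 0"
    then have e2: "\<epsilon> / 2 > 0" by simp
    obtain d1 where d1: "d1 > 0" "\<And>y. dist y x < d1 \<Longrightarrow> dist (f12 y) (f12 x) < \<epsilon> / 2"
      using c12 e2 unfolding continuous_at_eps_delta by blast
    obtain d2 where d2: "d2 > 0" "\<And>y. dist y x < d2 \<Longrightarrow> dist (f21 y) (f21 x) < \<epsilon> / 2"
      using c21 e2 unfolding continuous_at_eps_delta by blast
    \<comment> \<open>The summand 1 keeps \<open>M\<close> positive for zero directions and makes
      the distance estimate strict.\<close>
    define M where "M = norm b + norm e + 1"
    have M: "M > 0" by (simp add: M_def add_nonneg_pos)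
    define s where "s = min d1 d2 / M"
    have s: "s > 0" using d1 d2 M by (simp add: s_def)
    have near: "dist (x + \<xi> *\<^sub>R v + \<eta> *\<^sub>R w) x < min d1 d2"
      if "0 < \<xi>" "\<xi> < s" "0 < \<eta>" "\<eta> < s" "norm v + norm w = norm b + norm e" for \<xi> \<eta> v w
    proof -
      have "dist (x + \<xi> *\<^sub>R v + \<eta> *\<^sub>R w) x \<le> \<xi> * norm v + \<eta> * norm w"
        using norm_triangle_ineq[of "\<xi> *\<^sub>R v" "\<eta> *\<^sub>R w"] that by (simp add: dist_norm)
      also have "\<dots> \<le> s * norm v + s * norm w"
        using that by (intro add_mono mult_right_mono) auto
      also have "\<dots> = s * (norm b + norm e)" using that by (simp flip: distrib_left)
      also have "\<dots> < s * M" using s by (simp add: M_def)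
      also have "\<dots> = min d1 d2" using M by (simp add: s_def)
      finally show ?thesis .
    qed
    obtain \<xi> \<eta> where 1: "0 < \<xi>" "\<xi> < s" "0 < \<eta>" "\<eta> < s"
      "f (x + s *\<^sub>R b + s *\<^sub>R e) - f (x + s *\<^sub>R b) - f (x + s *\<^sub>R e) + f x = s\<^sup>2 * f12 (x + \<xi> *\<^sub>R b + \<eta> *\<^sub>R e)"
      using second_difference_mvt[OF f1 f12 s] .
    obtain \<xi>' \<eta>' where 2: "0 < \<xi>'" "\<xi>' < s" "0 < \<eta>'" "\<eta>' < s"
      "f (x + s *\<^sub>R e + s *\<^sub>R b) - f (x + s *\<^sub>R e) - f (x + s *\<^sub>R b) + f x = s\<^sup>2 * f21 (x + \<xi>' *\<^sub>R e + \<eta>' *\<^sub>R b)"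
      using second_difference_mvt[OF f2 f21 s] .
    have "x + s *\<^sub>R e + s *\<^sub>R b = x + s *\<^sub>R b + s *\<^sub>R e" by (simp add: algebra_simps)
    from 2(5)[unfolded this] have "s\<^sup>2 * f12 (x + \<xi> *\<^sub>R b + \<eta> *\<^sub>R e) = s\<^sup>2 * f21 (x + \<xi>' *\<^sub>R e + \<eta>' *\<^sub>R b)"
      using 1(5) by linarith
    then have eq: "f12 (x + \<xi> *\<^sub>R b + \<eta> *\<^sub>R e) = f21 (x + \<xi>' *\<^sub>R e + \<eta>' *\<^sub>R b)" using s by simp
    have "dist (f12 (x + \<xi> *\<^sub>R b + \<eta> *\<^sub>R e)) (f12 x) < \<epsilon> / 2"
      using d1(2) near[OF 1(1-4), of b e] by simp
    moreover have "dist (f21 (x + \<xi>' *\<^sub>R e + \<eta>' *\<^sub>R b)) (f21 x) < \<epsilon> / 2"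
      using d2(2) near[OF 2(1-4), of e b] by simp
    ultimately show "dist (f12 x) (f21 x) \<le> 0 + \<epsilon>"
      unfolding eq using dist_triangle3[of "f12 x" "f21 x" "f21 (x + \<xi>' *\<^sub>R e + \<eta>' *\<^sub>R b)"] by linarith
  qed
  then show ?thesis by simp
qed

section \<open>Global maxima and integrals of derivatives\<close>

lemma attains_sup_if_eventually_less:
  fixes f :: "'a::euclidean_space \<Rightarrow> real"
  assumes cont: "continuous_on UNIV f" and less: "\<forall>\<^sub>F x in at_infinity. f x < f a"
  obtains x where "\<And>y. f y \<le> f x"
proof -
  obtain r where r: "\<And>x. norm x \<ge> r \<Longrightarrow> f x < f a" using less unfolding eventually_at_infinity by blast
  have a: "a \<in> cball 0 r" using r[of a] by force
  obtain x where x: "x \<in> cball 0 r" "\<And>y. y \<in> cball 0 r \<Longrightarrow> f y \<le> f x"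
    using continuous_attains_sup[of "cball 0 r" f] a continuous_on_subset[OF cont] by (metis compact_cball empty_iff subset_UNIV)
  have "f y \<le> f x" for y
    using x(2)[of y] x(2)[OF a] r[of y] by (cases "norm y \<le> r") auto
  then show thesis using that by blast
qed

lemma laplacian_le_0_at_max:
  fixes w :: "'a::euclidean_space \<Rightarrow> real" and w1 w2 :: "'a \<Rightarrow> 'a \<Rightarrow> real"
  assumes w1: "\<And>b. b \<in> Basis \<Longrightarrow> has_dir_deriv b w (w1 b)"
    and w2: "\<And>b. b \<in> Basis \<Longrightarrow> has_dir_deriv b (w1 b) (w2 b)"
    and mx: "\<And>y. w y \<le> w x"
  shows "(\<Sum>b\<in>Basis. w2 b x) \<le> 0"
proof (rule sum_nonpos)
  fix b :: 'a assume b: "b \<in> Basis"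
  show "w2 b x \<le> 0"
  proof (rule second_derivative_le_0_at_local_max[where \<delta> = 1])
    show "((\<lambda>t. w (x + t *\<^sub>R b)) has_real_derivative w1 b (x + t *\<^sub>R b)) (at t)" for t
      by (rule has_dir_derivD[OF w1[OF b]])
    show "((\<lambda>t. w1 b (x + t *\<^sub>R b)) has_real_derivative w2 b x) (at 0)"
      using has_dir_derivD[OF w2[OF b], of x 0] by simp
  qed (use mx in auto)
qed

text \<open>This replaces the divergence theorem: difference quotients of \<open>g\<close> integrate
  to 0 by translation invariance and converge to \<open>g'\<close>. The bound on \<open>g'\<close>
  along whole segments yields, by the mean value theorem, the majorant for dominated
  convergence.\<close>

lemma integral_dir_deriv_eq_0:
  fixes g g' W :: "'a::euclidean_space \<Rightarrow> real"
  assumes g: "has_dir_deriv b g g'" and W: "integrable lborel W"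
    and gm: "g \<in> borel_measurable borel" and g'm: "g' \<in> borel_measurable borel"
    and gW: "\<And>x. \<bar>g x\<bar> \<le> W x" and g'W: "\<And>x t. \<bar>t\<bar> \<le> 1 \<Longrightarrow> \<bar>g' (x + t *\<^sub>R b)\<bar> \<le> W x"
  shows "(\<integral>x. g' x \<partial>lborel) = 0"
proof -
  define h :: "nat \<Rightarrow> real" where "h n = 1 / Suc n" for n
  have h: "h n > 0" "h n \<le> 1" for n by (auto simp: h_def)
  define Q where "Q n x = (g (x + h n *\<^sub>R b) - g x) / h n" for n x
  have ig: "integrable lborel g"
    by (rule Bochner_Integration.integrable_bound[OF W]) (use gm gW in \<open>auto intro!: AE_I2 order.trans[OF gW]\<close>)
  have shift: "integrable lborel (\<lambda>x. g (x + c))" "(\<integral>x. g (x + c) \<partial>lborel) = (\<integral>x. g x \<partial>lborel)" for c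
  proof -
    have d: "distr lborel borel ((+) c) = lborel" by (rule lborel_distr_plus)
    have "integrable (distr lborel borel ((+) c)) g" unfolding d by (rule ig)
    then show "integrable lborel (\<lambda>x. g (x + c))"
      using gm by (subst (asm) integrable_distr_eq) (auto simp: add.commute)
    have "(\<integral>x. g x \<partial>distr lborel borel ((+) c)) = (\<integral>x. g (c + x) \<partial>lborel)"
      using gm by (subst integral_distr) auto
    then show "(\<integral>x. g (x + c) \<partial>lborel) = (\<integral>x. g x \<partial>lborel)"
      unfolding d by (simp add: add.commute)
  qed
  have Q0: "(\<integral>x. Q n x \<partial>lborel) = 0" for n
    unfolding Q_def using shift ig by simp
  have "(\<lambda>n. \<integral>x. Q n x \<partial>lborel) \<longlonglongrightarrow> (\<integral>x. g' x \<partial>lborel)"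
  proof (rule integral_dominated_convergence[OF _ _ W])
    show "AE x in lborel. (\<lambda>n. Q n x) \<longlonglongrightarrow> g' x"
    proof (rule AE_I2)
      fix x
      have "((\<lambda>t. (g (x + t *\<^sub>R b) - g x) / t) \<longlongrightarrow> g' x) (at 0)"
        using has_dir_derivD[OF g, of x 0] by (simp add: DERIV_def)
      moreover have "filterlim h (at 0) sequentially"
        unfolding h_def filterlim_at using LIMSEQ_inverse_real_of_nat by (auto simp: inverse_eq_divide)
      ultimately show "(\<lambda>n. Q n x) \<longlonglongrightarrow> g' x"
        unfolding Q_def by (rule filterlim_compose)
    qed
    show "AE x in lborel. norm (Q n x) \<le> W x" for n
    proof (rule AE_I2)
      fix x
      have "\<bar>g (x + h n *\<^sub>R b) - g x\<bar> \<le> W x * \<bar>h n\<bar>"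
        by (rule has_dir_deriv_mvt[OF g]) (use g'W h[of n] in force)
      then show "norm (Q n x) \<le> W x" using h[of n] by (simp add: Q_def field_simps)
    qed
  qed (use gm g'm in \<open>auto simp: Q_def\<close>)
  then show ?thesis unfolding Q0 by (simp add: LIMSEQ_const_iff)
qed

section \<open>An integrable comparison function\<close>

text \<open>The scale \<open>c\<close> is free so that the Laplacian can be made a small multiple of
  the weight itself; \<open>k\<close> sets the rate of decay.\<close>

definition weight :: "real \<Rightarrow> nat \<Rightarrow> 'a::euclidean_space \<Rightarrow> real" where
  "weight c k x = 1 / (1 + c * (x \<bullet> x)) ^ k"

lemma weight_base_ge_1: "c \<ge> 0 \<Longrightarrow> 1 + c * (x \<bullet> x) \<ge> (1::real)"
  by simp

lemma weight_pos: "c \<ge> 0 \<Longrightarrow> weight c k x > 0"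
  using weight_base_ge_1[of c x] unfolding weight_def by (simp add: add_pos_nonneg)

lemma continuous_weight: "c \<ge> 0 \<Longrightarrow> continuous_on UNIV (weight c k)"
  unfolding weight_def
  by (intro continuous_intros ballI power_not_zero) (metis weight_base_ge_1 not_one_le_zero)

text \<open>From \<open>norm x \<le> norm y + 2\<close> one gets
  \<open>|x|^2 \<le> 2 |y|^2 + 8\<close>, and 9 = 1 + 8 absorbs the constants. The distance 2
  matches the balls of the derivative bounds, whose suprema are thus brought back to the
  centre.\<close>

lemma weight_shift:
  assumes "0 \<le> c" "c \<le> 1" "norm (y - x) \<le> 2"
  shows "weight c k y \<le> 9 ^ k * weight c k x"
proof -
  have "norm x \<le> norm y + 2" using assms(3) norm_triangle_ineq2[of x y] by (simp add: norm_minus_commute)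
  then have "(norm x)^2 \<le> (norm y + 2)^2" by (intro power_mono) auto
  also have "\<dots> \<le> 2 * (norm y)^2 + 8" using zero_le_power2[of "norm y - 2"] by (simp add: power2_eq_square algebra_simps)
  finally have "c * (x \<bullet> x) \<le> c * (2 * (y \<bullet> y) + 8)"
    using assms by (intro mult_left_mono) (auto simp: power2_norm_eq_inner)
  also have "\<dots> \<le> 2 * (c * (y \<bullet> y)) + 8" using assms by (simp add: algebra_simps)
  also have "\<dots> \<le> 9 * (c * (y \<bullet> y)) + 8" using assms by simp
  finally have "1 + c * (x \<bullet> x) \<le> 9 * (1 + c * (y \<bullet> y))" by simp
  then have "(1 + c * (x \<bullet> x)) ^ k \<le> (9 * (1 + c * (y \<bullet> y))) ^ k"
    using assms by (intro power_mono) auto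
  then show ?thesis
    using weight_base_ge_1[of c x] weight_base_ge_1[of c y] assms
    unfolding power_mult_distrib
    by (simp add: weight_def divide_simps add_pos_nonneg mult.commute)
qed

lemma weight_dir_deriv:
  fixes c :: real
  assumes "c \<ge> 0"
  shows "has_dir_deriv b (weight c k) (\<lambda>x. - (2 * real k * c * (x \<bullet> b)) * weight c (Suc k) x)"
  unfolding has_dir_deriv_def
proof
  fix y :: 'a
  let ?S = "\<lambda>t. 1 + c * ((y + t *\<^sub>R b) \<bullet> (y + t *\<^sub>R b))"
  have S: "?S t \<noteq> 0" for t using weight_base_ge_1[OF assms, of "y + t *\<^sub>R b"] by linarith
  have S': "?S = (\<lambda>t. 1 + c * (y \<bullet> y + 2 * t * (y \<bullet> b) + t^2 * (b \<bullet> b)))"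
    by (simp add: inner_add_left inner_add_right inner_commute power2_eq_square algebra_simps)
  have "(?S has_real_derivative 2 * c * (y \<bullet> b)) (at 0)"
    unfolding S' by (auto intro!: derivative_eq_intros)
  from DERIV_inverse_fun[OF DERIV_power[OF this, of k]] S[of 0]
  show "((\<lambda>t. weight c k (y + t *\<^sub>R b)) has_real_derivative
      - (2 * real k * c * (y \<bullet> b)) * weight c (Suc k) y) (at 0)"
    unfolding weight_def inverse_eq_divide
    by (cases k) (auto simp: divide_simps elim!: DERIV_cong)
qed

lemma weight_dir_deriv2:
  fixes c :: real
  assumes "c \<ge> 0" "b \<in> Basis"
  shows "has_dir_deriv b (\<lambda>x. - (2 * real k * c * (x \<bullet> b)) * weight c (Suc k) x)
    (\<lambda>x. 4 * real k * real (Suc k) * c\<^sup>2 * (x \<bullet> b)\<^sup>2 * weight c (k + 2) x - 2 * real k * c * weight c (Suc k) x)"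
  unfolding has_dir_deriv_def
proof
  fix y :: 'a
  have l: "((\<lambda>t. - (2 * real k * c * ((y + t *\<^sub>R b) \<bullet> b))) has_real_derivative - (2 * real k * c)) (at 0)"
    using assms by (auto intro!: derivative_eq_intros simp: inner_add_left)
  have w: "((\<lambda>t. weight c (Suc k) (y + t *\<^sub>R b)) has_real_derivative
      - (2 * real (Suc k) * c * (y \<bullet> b)) * weight c (Suc (Suc k)) y) (at 0)"
    using weight_dir_deriv[OF assms(1), of b "Suc k"] unfolding has_dir_deriv_def by blast
  show "((\<lambda>t. - (2 * real k * c * ((y + t *\<^sub>R b) \<bullet> b)) * weight c (Suc k) (y + t *\<^sub>R b)) has_real_derivative
    4 * real k * real (Suc k) * c\<^sup>2 * (y \<bullet> b)\<^sup>2 * weight c (k + 2) y - 2 * real k * c * weight c (Suc k) y) (at 0)"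
    by (rule DERIV_cong[OF DERIV_mult[OF l w]]) (simp add: power2_eq_square algebra_simps)
qed

text \<open>Drop the negative terms and use \<open>c |x|^2 \<le> (1 + c |x|^2)^2\<close>. The point
  is the factor \<open>c\<close> left on the right.\<close>

lemma weight_laplacian_le:
  fixes x :: "'a::euclidean_space" and c :: real
  assumes "c \<ge> 0"
  shows "(\<Sum>b\<in>Basis. 4 * real k * real (Suc k) * c\<^sup>2 * (x \<bullet> b)\<^sup>2 * weight c (k + 2) x - 2 * real k * c * weight c (Suc k) x)
    \<le> 4 * real k * real (Suc k) * c * weight c k x"
proof -
  let ?S = "1 + c * (x \<bullet> x)"
  have S: "?S \<ge> 1" by (rule weight_base_ge_1[OF assms])
  have "(\<Sum>b\<in>Basis. 4 * real k * real (Suc k) * c\<^sup>2 * (x \<bullet> b)\<^sup>2 * weight c (k + 2) x - 2 * real k * c * weight c (Suc k) x)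
    \<le> (\<Sum>b\<in>Basis. (4 * real k * real (Suc k) * c\<^sup>2 * weight c (k + 2) x) * (x \<bullet> b)\<^sup>2)"
    using weight_pos[OF assms, of "Suc k" x] assms by (intro sum_mono) (simp add: mult_ac)
  also have "\<dots> = 4 * real k * real (Suc k) * c * ((c * (x \<bullet> x)) * weight c (k + 2) x)"
    unfolding sum_distrib_left[symmetric] euclidean_inner[of x x] by (simp add: power2_eq_square)
  also have "\<dots> \<le> 4 * real k * real (Suc k) * c * weight c k x"
  proof (rule mult_left_mono)
    have "c * (x \<bullet> x) \<le> ?S * ?S" using S mult_mono[of 1 ?S "c * (x \<bullet> x)" ?S] assms by simp
    then show "c * (x \<bullet> x) * weight c (k + 2) x \<le> weight c k x"
      using S by (simp add: weight_def divide_simps)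
  qed (use assms in simp)
  finally show ?thesis .
qed

text \<open>Each of the \<open>DIM('a)\<close> factors is at most the one-dimensional
  \<open>1 / (1 + c t^2)\<close> in its own coordinate, and the product of these integrates by
  Tonelli.\<close>

lemma integrable_weight:
  assumes "c > 0"
  shows "integrable lborel (weight c DIM('a) :: 'a::euclidean_space \<Rightarrow> real)"
proof -
  define f :: "real \<Rightarrow> real" where "f t = 1 / (1 + c * t\<^sup>2)" for t
  have f0: "f t \<ge> 0" for t using assms by (simp add: f_def add_nonneg_nonneg)
  have "integrable lborel (\<lambda>t::real. inverse (1 + t\<^sup>2))"
    using integrable_inverse_1_plus_square by (simp add: set_integrable_def einterval_def)
  then have "integrable lborel (\<lambda>t. inverse (1 + (0 + sqrt c * t)\<^sup>2))"
    by (rule lborel_integrable_real_affine) (use assms in simp)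
  then have fi: "integrable lborel f"
    using assms by (simp add: f_def[abs_def] power_mult_distrib inverse_eq_divide)
  then have fm[measurable]: "f \<in> borel_measurable borel" by (simp add: borel_measurable_integrable)
  have fin: "(\<integral>\<^sup>+t. ennreal (f t) \<partial>lborel) < \<infinity>"
    using fi f0 by (simp add: integrable_iff_bounded)
  have prod: "integrable lborel (\<lambda>x::'a. \<Prod>b\<in>Basis. f (x \<bullet> b))"
  proof (rule integrableI_nonneg)
    show "AE x::'a in lborel. 0 \<le> (\<Prod>b\<in>Basis. f (x \<bullet> b))" by (intro AE_I2 prod_nonneg) (simp add: f0)
    have "(\<integral>\<^sup>+x. ennreal (\<Prod>b\<in>Basis. f ((x::'a) \<bullet> b)) \<partial>lborel) = (\<integral>\<^sup>+x. (\<Prod>b\<in>Basis. ennreal (f ((x::'a) \<bullet> b))) \<partial>lborel)"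
      by (simp add: prod_ennreal f0)
    also have "\<dots> = (\<Prod>b\<in>(Basis::'a set). (\<integral>\<^sup>+t. ennreal (f t) \<partial>lborel))"
      by (rule nn_integral_lborel_prod) auto
    also have "\<dots> < \<infinity>" using fin by (simp add: power_less_top_ennreal)
    finally show "(\<integral>\<^sup>+x. ennreal (\<Prod>b\<in>Basis. f ((x::'a) \<bullet> b)) \<partial>lborel) < \<infinity>" .
  qed measurable
  show ?thesis
  proof (rule Bochner_Integration.integrable_bound[OF prod])
    show "weight c DIM('a) \<in> borel_measurable lborel"
      using borel_measurable_continuous_onI[OF continuous_weight[of c "DIM('a)"]] assms by simp
    show "AE x::'a in lborel. norm (weight c DIM('a) x) \<le> norm (\<Prod>b\<in>Basis. f (x \<bullet> b))"
    proof (rule AE_I2)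
      fix x :: 'a
      have "(\<Prod>b\<in>(Basis::'a set). 1 / (1 + c * (x \<bullet> x))) \<le> (\<Prod>b\<in>Basis. f (x \<bullet> b))"
      proof (rule prod_mono, intro conjI)
        fix b :: 'a assume b: "b \<in> Basis"
        have "(x \<bullet> b)\<^sup>2 \<le> x \<bullet> x"
          using Basis_le_norm[OF b, of x] power_mono[of "\<bar>x \<bullet> b\<bar>" "norm x" 2]
          by (simp add: power2_norm_eq_inner)
        then show "1 / (1 + c * (x \<bullet> x)) \<le> f (x \<bullet> b)"
          unfolding f_def using assms by (intro divide_left_mono) (auto intro!: add_pos_nonneg mult_pos_pos)
      qed (use assms in simp)
      then show "norm (weight c DIM('a) x) \<le> norm (\<Prod>b\<in>Basis. f (x \<bullet> b))"
        using weight_pos[of c "DIM('a)" x] assms by (simp add: weight_def power_one_over abs_of_pos)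
    qed
  qed
qed

lemma dir_deriv_bound:
  assumes f: "has_dir_deriv b f f'"
    and K: "\<And>t. 0 < t \<Longrightarrow> t < 1 \<Longrightarrow> \<bar>f (x + t *\<^sub>R b) - f x\<bar> \<le> K * t"
  shows "\<bar>f' x\<bar> \<le> K"
proof -
  have "((\<lambda>t. (f (x + t *\<^sub>R b) - f x) / t) \<longlongrightarrow> f' x) (at 0)"
    using has_dir_derivD[OF f, of x 0] by (simp add: DERIV_def)
  then have lim: "((\<lambda>t. \<bar>(f (x + t *\<^sub>R b) - f x) / t\<bar>) \<longlongrightarrow> \<bar>f' x\<bar>) (at_right 0)"
    by (intro tendsto_rabs) (auto intro: tendsto_mono[OF at_le])
  have "\<forall>\<^sub>F t in at_right 0. \<bar>(f (x + t *\<^sub>R b) - f x) / t\<bar> \<le> K"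
    unfolding eventually_at_right_field
    by (rule exI[of _ 1]) (use K in \<open>auto simp: abs_divide pos_divide_le_eq\<close>)
  then show ?thesis by (rule tendsto_upperbound[OF lim]) simp
qed

section \<open>Solutions below the critical height\<close>

text \<open>The assumption \<open>m_less\<close> says that \<open>m\<close> lies strictly below the
  positive zero of \<open>F\<close>; the strictness yields a positive quadratic coefficient
  later.\<close>

locale bounded_solution =
  fixes u :: "'a::euclidean_space \<Rightarrow> real" and p m :: real
  assumes p: "1 < p" and sol: "classical_solution p u"
    and pos: "0 < u x" and le_m: "u x \<le> m"
    and m_less: "m powr (p - 1) < (p + 1) / 2"
begin

abbreviation d where "d b \<equiv> partial_deriv b u"
abbreviation dd where "dd b e \<equiv> partial_deriv b (partial_deriv e u)"

definition F :: "real \<Rightarrow> real" where "F s = s\<^sup>2 / 2 - s powr (p + 1) / (p + 1)"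
text \<open>A Lipschitz constant of \<open>s - s powr p\<close> on the interval from 0 to
  \<open>m\<close>. With Laplacian bound \<open>L * A\<close>, the gradient estimate gives the
  factor \<open>K\<close> defined next.\<close>

definition L :: real where "L = 1 + p * m powr (p - 1)"
definition K :: real where "K = DIM('a) + L"

lemma m_pos: "m > 0"
  using pos[of undefined] le_m[of undefined] by linarith

lemma L_ge_1: "L \<ge> 1" and K_ge_1: "K \<ge> 1"
  using p by (auto simp: L_def K_def)

lemma differentiable: "u differentiable (at x)" "b \<in> Basis \<Longrightarrow> d b differentiable (at x)"
  and continuous_dd: "b \<in> Basis \<Longrightarrow> e \<in> Basis \<Longrightarrow> continuous_on UNIV (dd b e)"
  using sol unfolding classical_solution_def C2_def C1_def by blast+

lemma continuous_u: "continuous_on UNIV u"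
  and continuous_d: "b \<in> Basis \<Longrightarrow> continuous_on UNIV (d b)"
  using differentiable
  by (auto simp: continuous_on_eq_continuous_within intro!: differentiable_imp_continuous_within)

lemma dir_deriv_u: "has_dir_deriv b u (d b)"
  and dir_deriv_d: "e \<in> Basis \<Longrightarrow> has_dir_deriv b (d e) (dd b e)"
  using differentiable by (auto intro!: has_dir_deriv_partial)

lemma laplacian_eq: "(\<Sum>b\<in>Basis. dd b b x) = u x - u x powr p"
proof -
  have "- laplacian u x + u x = u x powr p" using sol by (simp add: classical_solution_def)
  then show ?thesis by (simp add: laplacian_def)
qed

lemma dd_commute:
  assumes "b \<in> Basis" "e \<in> Basis"
  shows "dd b e x = dd e b x"
  by (rule mixed_dir_deriv_eq[OF dir_deriv_u dir_deriv_d dir_deriv_u dir_deriv_d])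
     (use assms continuous_dd in \<open>auto simp: continuous_on_eq_continuous_at\<close>)

section \<open>The nonlinearity and its primitive on the range of \<open>u\<close>\<close>

lemma powr_Suc: "s > 0 \<Longrightarrow> s powr p = s * s powr (p - 1)"
  by (simp add: powr_diff)

lemma powr_le_m: "0 < s \<Longrightarrow> s \<le> m \<Longrightarrow> s powr (p - 1) \<le> m powr (p - 1)"
  using p by (intro powr_mono2) auto

text \<open>Factor out \<open>s\<^sup>2\<close> and use monotonicity of
  \<open>s powr (p - 1)\<close>. The lower bound lets smallness of \<open>F (u x)\<close> be read as
  smallness of \<open>u x\<close>.\<close>

lemma F_bounds:
  assumes "0 < s" "s \<le> m"
  shows "(1 / 2 - m powr (p - 1) / (p + 1)) * s\<^sup>2 \<le> F s" "F s \<le> s\<^sup>2"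
proof -
  have eq: "s powr (p + 1) = s\<^sup>2 * s powr (p - 1)"
    using powr_add[of s 2 "p - 1"] assms by (simp add: add.commute)
  have "s\<^sup>2 * s powr (p - 1) \<le> s\<^sup>2 * m powr (p - 1)"
    using powr_le_m[OF assms] by (intro mult_left_mono) auto
  then have "s\<^sup>2 * s powr (p - 1) / (p + 1) \<le> s\<^sup>2 * m powr (p - 1) / (p + 1)"
    using p by (intro divide_right_mono) auto
  then show "(1 / 2 - m powr (p - 1) / (p + 1)) * s\<^sup>2 \<le> F s"
    unfolding F_def eq by (simp add: algebra_simps)
  have "s powr (p + 1) / (p + 1) \<ge> 0" using p by simp
  then show "F s \<le> s\<^sup>2" unfolding F_def using zero_le_power2[of s] by linarith
qed

lemma F_coeff_pos: "1 / 2 - m powr (p - 1) / (p + 1) > 0"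
  using m_less p by (simp add: field_simps)

lemma F_pos: "0 < s \<Longrightarrow> s \<le> m \<Longrightarrow> F s > 0"
  using F_coeff_pos by (intro less_le_trans[OF _ F_bounds(1)] mult_pos_pos) auto

lemma F_deriv: "0 < s \<Longrightarrow> (F has_real_derivative s - s powr p) (at s)"
  unfolding F_def using p by (auto intro!: derivative_eq_intros)

lemma nonlinearity_lipschitz:
  assumes "0 < s" "s \<le> m" "0 < t" "t \<le> m"
  shows "\<bar>(s - s powr p) - (t - t powr p)\<bar> \<le> L * \<bar>s - t\<bar>"
proof -
  have "norm ((s - s powr p) - (t - t powr p)) \<le> L * norm (s - t)"
  proof (rule field_differentiable_bound[of "{0<..m}" "\<lambda>s. s - s powr p" "\<lambda>s. 1 - p * s powr (p - 1)"])
    fix z assume z: "z \<in> {0<..m}"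
    show "((\<lambda>s. s - s powr p) has_field_derivative 1 - p * z powr (p - 1)) (at z within {0<..m})"
      using z by (auto intro!: derivative_eq_intros)
    have "p * z powr (p - 1) \<le> p * m powr (p - 1)"
      using powr_le_m[of z] z p by (intro mult_left_mono) auto
    moreover have "0 \<le> p * z powr (p - 1)" using p by simp
    ultimately show "norm (1 - p * z powr (p - 1)) \<le> L" unfolding L_def by simp
  qed (use assms in auto)
  then show ?thesis by simp
qed

lemma nonlinearity_le:
  assumes "0 < s" "s \<le> m"
  shows "\<bar>s - s powr p\<bar> \<le> L * s"
proof -
  have "s * s powr (p - 1) \<le> s * m powr (p - 1)"
    using powr_le_m[OF assms] assms by (intro mult_left_mono) auto
  also have "\<dots> \<le> s * (p * m powr (p - 1))"
    using p assms by (intro mult_left_mono) (auto simp: mult_le_cancel_right1)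
  finally have "s powr p \<le> s * (p * m powr (p - 1))" by (simp add: powr_Suc assms)
  moreover have "0 \<le> s powr p" by simp
  moreover have "0 \<le> p * m powr (p - 1) * s" using p assms by simp
  ultimately show ?thesis using assms unfolding L_def by (simp add: algebra_simps abs_le_iff)
qed

section \<open>Derivative bounds and decay at infinity\<close>

lemma d_le:
  assumes b: "b \<in> Basis" and A: "\<And>y. y \<in> cball x 1 \<Longrightarrow> u y \<le> A"
  shows "\<bar>d b x\<bar> \<le> K * A"
proof -
  have "\<bar>d b x\<bar> \<le> DIM('a) * A + L * A"
  proof (rule gradient_estimate[OF b continuous_u dir_deriv_u dir_deriv_d])
    fix y assume y: "y \<in> cball x 1"
    show "\<bar>u y\<bar> \<le> A" using A[OF y] pos[of y] by simp
    have "\<bar>\<Sum>b\<in>Basis. dd b b y\<bar> \<le> L * u y"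
      unfolding laplacian_eq by (rule nonlinearity_le) (use pos le_m in auto)
    also have "\<dots> \<le> L * A" using A[OF y] L_ge_1 by (intro mult_left_mono) auto
    finally show "\<bar>\<Sum>b\<in>Basis. dd b b y\<bar> \<le> L * A" .
  qed
  then show ?thesis by (simp add: K_def algebra_simps)
qed

text \<open>The interior gradient estimate is applied to difference quotients of \<open>u\<close>, whose Laplacian
  is controlled because the nonlinearity is Lipschitz on the range of \<open>u\<close>.\<close>

lemma dd_le:
  assumes b: "b \<in> Basis" and e: "e \<in> Basis" and A: "\<And>y. y \<in> cball x 2 \<Longrightarrow> \<bar>d e y\<bar> \<le> A"
  shows "\<bar>dd e b x\<bar> \<le> K * A"
proof (rule dir_deriv_bound[OF dir_deriv_d[OF b]])
  fix t :: real assume t: "0 < t" "t < 1"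
  let ?h = "t *\<^sub>R e"
  have trans: "has_dir_deriv c (\<lambda>y. f (y + ?h) - f y) (\<lambda>y. f' (y + ?h) - f' y)"
    if "has_dir_deriv c f f'" for c f f'
    unfolding has_dir_deriv_def
  proof
    fix y
    have "((\<lambda>t. f ((y + ?h) + t *\<^sub>R c) - f (y + t *\<^sub>R c)) has_real_derivative f' (y + ?h) - f' y) (at 0)"
      using that unfolding has_dir_deriv_def by (intro DERIV_diff) blast+
    then show "((\<lambda>s. f (y + s *\<^sub>R c + ?h) - f (y + s *\<^sub>R c)) has_real_derivative f' (y + ?h) - f' y) (at 0)"
      by (simp add: algebra_simps)
  qed
  have diff: "\<bar>u (y + ?h) - u y\<bar> \<le> A * t" if y: "y \<in> cball x 1" for y
  proof -
    have "\<bar>u (y + ?h) - u y\<bar> \<le> A * \<bar>t\<bar>"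
    proof (rule has_dir_deriv_mvt[OF dir_deriv_u], rule A)
      fix s assume "\<bar>s\<bar> \<le> \<bar>t\<bar>"
      then show "y + s *\<^sub>R e \<in> cball x 2"
        using y t e norm_triangle_ineq[of "y - x" "s *\<^sub>R e"] by (simp add: dist_norm norm_minus_commute algebra_simps)
    qed
    then show ?thesis using t by simp
  qed
  \<comment> \<open>The left side is the \<open>b\<close>-derivative of a difference of translates,
    so no third derivatives occur. Radius 2 in the hypothesis is radius 1 for the estimate plus a
    shift by less than 1.\<close>
  have "\<bar>d b (x + ?h) - d b x\<bar> \<le> DIM('a) * (A * t) + L * (A * t)"
  proof (rule gradient_estimate[OF b _ trans[OF dir_deriv_u] trans[OF dir_deriv_d]])
    show "continuous_on UNIV (\<lambda>y. u (y + ?h) - u y)"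
      by (intro continuous_intros continuous_on_compose2[OF continuous_u]) auto
    fix y assume y: "y \<in> cball x 1"
    show "\<bar>u (y + ?h) - u y\<bar> \<le> A * t" by (rule diff[OF y])
    have "\<bar>\<Sum>c\<in>Basis. dd c c (y + ?h) - dd c c y\<bar> \<le> L * \<bar>u (y + ?h) - u y\<bar>"
      unfolding sum_subtractf laplacian_eq by (rule nonlinearity_lipschitz) (use pos le_m in auto)
    also have "\<dots> \<le> L * (A * t)" using diff[OF y] L_ge_1 by (intro mult_left_mono) auto
    finally show "\<bar>\<Sum>c\<in>Basis. dd c c (y + ?h) - dd c c y\<bar> \<le> L * (A * t)" .
  qed
  then show "\<bar>d b (x + ?h) - d b x\<bar> \<le> K * A * t" by (simp add: K_def algebra_simps)
qed

text \<open>Comparison principle: where \<open>u\<close> is small its Laplacian is at least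
  \<open>u / 2\<close>, while that of the barrier is at most a quarter of the barrier. At a positive
  maximum of \<open>u\<close> minus the barrier this gives \<open>u / 2 < u / 4\<close>.\<close>

lemma polynomial_decay:
  assumes lim: "(u \<longlongrightarrow> 0) at_infinity"
  obtains c C where "0 < c" "c \<le> 1" "0 < C" "\<And>x. u x \<le> C * weight c k x"
proof -
  \<comment> \<open>Makes the factor in \<open>weight_laplacian_le\<close> equal to
    \<open>k / (4 * (k + 1))\<close>, hence at most 1/4.\<close>
  define c :: real where "c = 1 / (16 * (real (Suc k))\<^sup>2)"
  have "(real (Suc k))\<^sup>2 \<ge> 1" by (rule one_le_power) simp
  then have "16 * (real (Suc k))\<^sup>2 \<ge> 1" by linarith
  then have c: "0 < c" "c \<le> 1" unfolding c_def by (subst divide_le_eq_1_pos | simp)+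
  have ck: "4 * real k * real (Suc k) * c \<le> 1 / 4" by (simp add: c_def divide_simps power2_eq_square)
  define r where "r = (1 / 2 :: real) powr (1 / (p - 1))"
  have r: "r > 0" "r powr (p - 1) = 1 / 2" using p by (auto simp: r_def powr_powr)
  obtain R where R: "\<And>x. norm x \<ge> R \<Longrightarrow> u x < r"
    using order_tendstoD(2)[OF lim r(1)] unfolding eventually_at_infinity by blast
  \<comment> \<open>Lifts the barrier above \<open>m\<close> on the ball of radius \<open>R\<close>,
    so a positive maximum lies where \<open>u x < r\<close>.\<close>
  define C where "C = m * (1 + c * R\<^sup>2) ^ k"
  have C: "C > 0" using m_pos c unfolding C_def by (intro mult_pos_pos zero_less_power) (auto intro: add_pos_nonneg)
  have near: "m \<le> C * weight c k x" if "norm x \<le> R" for x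
  proof -
    have "x \<bullet> x \<le> R\<^sup>2" using power_mono[OF that, of 2] by (simp add: power2_norm_eq_inner)
    then have "(1 + c * (x \<bullet> x)) ^ k \<le> (1 + c * R\<^sup>2) ^ k"
      using c by (intro power_mono) auto
    moreover have "(1 + c * (x \<bullet> x)) ^ k > 0" using c by (simp add: add_pos_nonneg)
    ultimately show ?thesis using m_pos by (simp add: C_def weight_def pos_le_divide_eq)
  qed
  let ?v = "\<lambda>x. u x - C * weight c k x"
  have "?v a \<le> 0" for a
  proof (rule ccontr)
    assume "\<not> ?v a \<le> 0"
    then have a: "?v a > 0" by simp
    have "\<forall>\<^sub>F x in at_infinity. u x < ?v a" by (rule order_tendstoD(2)[OF lim a])
    moreover have "C * weight c k x > 0" for x using C weight_pos[of c k x] c by simp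
    ultimately have "\<forall>\<^sub>F x in at_infinity. ?v x < ?v a"
      by (smt (verit) eventually_mono)
    moreover have "continuous_on UNIV ?v"
      using c by (intro continuous_intros continuous_u continuous_weight) auto
    ultimately obtain x where x: "\<And>y. ?v y \<le> ?v x" using attains_sup_if_eventually_less by blast
    then have vx: "?v x > 0" using a order.strict_trans2 by blast
    have "norm x > R" using near[of x] vx le_m[of x] by force
    then have "u x < r" using R by simp
    then have "u x powr (p - 1) \<le> 1 / 2" using powr_mono2[of "p - 1" "u x" r] r pos[of x] p by simp
    then have up: "u x powr p \<le> u x / 2"
      using powr_Suc[OF pos] mult_left_mono[of "u x powr (p - 1)" "1 / 2" "u x"] pos[of x] by simp
    let ?w1 = "\<lambda>b x. - (2 * real k * c * (x \<bullet> b)) * weight c (Suc k) x"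
    let ?w2 = "\<lambda>b x. 4 * real k * real (Suc k) * c\<^sup>2 * (x \<bullet> b)\<^sup>2 * weight c (k + 2) x - 2 * real k * c * weight c (Suc k) x"
    have lin: "has_dir_deriv b (\<lambda>x. f x - C * g x) (\<lambda>x. f' x - C * g' x)"
      if "has_dir_deriv b f f'" "has_dir_deriv b g g'" for b f f' g g'
      using that unfolding has_dir_deriv_def by (auto intro!: derivative_eq_intros)
    have "(\<Sum>b\<in>Basis. dd b b x - C * ?w2 b x) \<le> 0"
    proof (rule laplacian_le_0_at_max[of ?v "\<lambda>b x. d b x - C * ?w1 b x"])
      fix b :: 'a assume b: "b \<in> Basis"
      show "has_dir_deriv b ?v (\<lambda>x. d b x - C * ?w1 b x)"
        using c by (intro lin dir_deriv_u weight_dir_deriv) simp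
      show "has_dir_deriv b (\<lambda>x. d b x - C * ?w1 b x) (\<lambda>x. dd b b x - C * ?w2 b x)"
        using c b by (intro lin dir_deriv_d weight_dir_deriv2) auto
    qed (rule x)
    then have "u x - u x powr p \<le> C * (\<Sum>b\<in>Basis. ?w2 b x)"
      by (simp only: sum_subtractf[of "\<lambda>b. dd b b x"] laplacian_eq sum_distrib_left)
    also have "\<dots> \<le> C * (4 * real k * real (Suc k) * c * weight c k x)"
      using C c by (intro mult_left_mono weight_laplacian_le) auto
    also have "\<dots> \<le> C * (1 / 4 * weight c k x)"
      using C weight_pos[of c k x] c ck by (intro mult_left_mono mult_right_mono) auto
    finally show False using up vx pos[of x] by linarith
  qed
  then show thesis using that[OF c C] by simp
qed

end

section \<open>Pohozaev's identity\<close>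

context bounded_solution
begin

definition energy :: "'a \<Rightarrow> real" where
  "energy x = (\<Sum>i\<in>Basis. d i x * d i x) / 2 + F (u x)"

text \<open>Component \<open>j\<close> of \<open>(x . grad u) grad u - energy(x) x\<close>: the
  stress tensor of the energy density contracted with the generator x of dilations.\<close>

definition pohozaev_field :: "'a \<Rightarrow> 'a \<Rightarrow> real" where
  "pohozaev_field j x = (\<Sum>i\<in>Basis. (x \<bullet> i) * (d i x * d j x)) - (x \<bullet> j) * energy x"

definition pohozaev_field' :: "'a \<Rightarrow> 'a \<Rightarrow> real" where
  "pohozaev_field' j x =
    (\<Sum>i\<in>Basis. (j \<bullet> i) * (d i x * d j x) + (x \<bullet> i) * (dd j i x * d j x + d i x * dd j j x))
    - (energy x + (x \<bullet> j) * ((\<Sum>i\<in>Basis. d i x * dd j i x) + (u x - u x powr p) * d j x))"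

lemma continuous_energy: "continuous_on UNIV energy"
  unfolding energy_def F_def
  by (intro continuous_intros continuous_u continuous_d)
     (use p pos in \<open>auto simp: less_imp_neq[symmetric]\<close>)

lemma continuous_pohozaev:
  assumes "j \<in> Basis"
  shows "continuous_on UNIV (pohozaev_field j)" "continuous_on UNIV (pohozaev_field' j)"
  unfolding pohozaev_field_def pohozaev_field'_def
  by (intro continuous_intros continuous_u continuous_d continuous_dd continuous_energy assms;
      use p pos assms in \<open>auto simp: less_imp_neq[symmetric]\<close>)+

lemma dir_deriv_pohozaev_field:
  assumes j: "j \<in> Basis"
  shows "has_dir_deriv j (pohozaev_field j) (pohozaev_field' j)"
  unfolding has_dir_deriv_def
proof
  fix y
  have du: "((\<lambda>t. u (y + t *\<^sub>R j)) has_real_derivative d j y) (at 0)"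
    using has_dir_derivD[OF dir_deriv_u, of y j 0] by simp
  have ddu: "((\<lambda>t. d i (y + t *\<^sub>R j)) has_real_derivative dd j i y) (at 0)" if "i \<in> Basis" for i
    using has_dir_derivD[OF dir_deriv_d[OF that], of y j 0] by simp
  have x: "((\<lambda>t. (y + t *\<^sub>R j) \<bullet> i) has_real_derivative j \<bullet> i) (at 0)" for i
    by (auto intro!: derivative_eq_intros simp: inner_add_left)
  have Fu: "((\<lambda>t. F (u (y + t *\<^sub>R j))) has_real_derivative (u y - u y powr p) * d j y) (at 0)"
    using DERIV_chain2[OF F_deriv du] pos by simp
  have "((\<lambda>t. \<Sum>i\<in>Basis. d i (y + t *\<^sub>R j) * d i (y + t *\<^sub>R j)) has_real_derivative
      (\<Sum>i\<in>Basis. 2 * (d i y * dd j i y))) (at 0)"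
    by (rule DERIV_sum, rule DERIV_cong[OF DERIV_mult[OF ddu ddu]]) auto
  from DERIV_add[OF DERIV_cdivide[OF this, of 2] Fu]
  have E: "((\<lambda>t. energy (y + t *\<^sub>R j)) has_real_derivative
      (\<Sum>i\<in>Basis. d i y * dd j i y) + (u y - u y powr p) * d j y) (at 0)"
    unfolding energy_def by (simp flip: sum_distrib_left)
  have "((\<lambda>t. \<Sum>i\<in>Basis. ((y + t *\<^sub>R j) \<bullet> i) * (d i (y + t *\<^sub>R j) * d j (y + t *\<^sub>R j))) has_real_derivative
      (\<Sum>i\<in>Basis. (j \<bullet> i) * (d i y * d j y) + (y \<bullet> i) * (dd j i y * d j y + d i y * dd j j y))) (at 0)"
    by (rule DERIV_sum, rule DERIV_cong[OF DERIV_mult[OF x DERIV_mult[OF ddu ddu[OF j]]]])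
       (auto simp: algebra_simps)
  from DERIV_diff[OF this DERIV_mult[OF x E]]
  show "((\<lambda>t. pohozaev_field j (y + t *\<^sub>R j)) has_real_derivative pohozaev_field' j y) (at 0)"
    unfolding pohozaev_field_def pohozaev_field'_def by (rule DERIV_cong) (use j in \<open>simp add: mult.commute\<close>)
qed

text \<open>Two groups of terms contain second derivatives. \<open>B1\<close> cancels by their
  symmetry, and \<open>B2\<close> cancels because the equation turns the Laplacian into
  \<open>u - u powr p\<close>; \<open>S - DIM('a) * energy x\<close> remains.\<close>

lemma pohozaev_divergence:
  "(\<Sum>j\<in>Basis. pohozaev_field' j x) =
    - ((DIM('a) / 2 - 1) * (\<Sum>i\<in>Basis. d i x * d i x) + DIM('a) * F (u x))"
proof -
  define S where "S = (\<Sum>i\<in>Basis. d i x * d i x)"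
  define B1 where "B1 = (\<Sum>j\<in>Basis. \<Sum>i\<in>Basis. (x \<bullet> i) * (dd j i x * d j x))"
  define B2 where "B2 = (\<Sum>i\<in>Basis. (x \<bullet> i) * d i x) * (u x - u x powr p)"
  have "(\<Sum>i\<in>Basis. (j \<bullet> i) * (d i x * d j x)) = d j x * d j x" if "j \<in> Basis" for j
  proof -
    have "(\<Sum>i\<in>Basis. (j \<bullet> i) * (d i x * d j x)) = (\<Sum>i\<in>Basis. if j = i then d j x * d j x else 0)"
      using that by (intro sum.cong) (auto simp: inner_Basis)
    then show ?thesis using that by simp
  qed
  then have 1: "(\<Sum>j\<in>Basis. \<Sum>i\<in>Basis. (j \<bullet> i) * (d i x * d j x)) = S"
    by (simp add: S_def)
  have 2: "(\<Sum>j\<in>Basis. \<Sum>i\<in>Basis. (x \<bullet> i) * (d i x * dd j j x)) = B2"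
    unfolding B2_def laplacian_eq[symmetric] sum_product by (subst sum.swap) (simp add: mult_ac)
  have "(\<Sum>j\<in>Basis. (x \<bullet> j) * (\<Sum>i\<in>Basis. d i x * dd j i x))
      = (\<Sum>j\<in>Basis. \<Sum>i\<in>Basis. (x \<bullet> j) * (dd i j x * d i x))"
    unfolding sum_distrib_left by (intro sum.cong refl) (simp add: dd_commute mult_ac)
  also have "\<dots> = B1" unfolding B1_def by (rule sum.swap)
  finally have 3: "(\<Sum>j\<in>Basis. (x \<bullet> j) * (\<Sum>i\<in>Basis. d i x * dd j i x)) = B1" .
  have 4: "(\<Sum>j\<in>Basis. (x \<bullet> j) * ((u x - u x powr p) * d j x)) = B2"
    unfolding B2_def by (simp add: sum_distrib_left mult_ac)
  have "(\<Sum>j\<in>Basis. pohozaev_field' j x) = S + (B1 + B2) - (DIM('a) * energy x + (B1 + B2))"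
    unfolding pohozaev_field'_def
    by (simp add: sum_subtractf sum.distrib distrib_left 1 2 3 4 flip: B1_def)
  then show ?thesis by (simp add: energy_def S_def algebra_simps)
qed

text \<open>If \<open>u\<close> vanishes at infinity, Pohozaev's identity would force the integral of a positive
  function to be \<open>0\<close>: below the critical height the primitive \<open>F\<close> is positive.\<close>

lemma not_vanishing:
  assumes dim: "DIM('a) \<ge> 2" and lim: "(u \<longlongrightarrow> 0) at_infinity"
  shows False
proof -
  let ?N = "DIM('a)"
  \<comment> \<open>One power more than integrability needs: the spare factor
    \<open>1 + c |x|^2\<close> absorbs the coordinate \<open>x \<bullet> i\<close> in the Pohozaev
    field.\<close>
  obtain c C0 where c: "0 < c" "c \<le> 1" and C0: "0 < C0" and u0: "\<And>x. u x \<le> C0 * weight c (Suc ?N) x"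
    using polynomial_decay[OF lim] by metis
  let ?V = "weight c (Suc ?N) :: 'a \<Rightarrow> real" and ?W = "weight c ?N :: 'a \<Rightarrow> real"
  have V0: "?V x > 0" and W0: "?W x > 0" for x using weight_pos[of c] c by auto
  have K0: "K > 0" using K_ge_1 by linarith
  have L0: "L > 0" using L_ge_1 by linarith
  have shiftV: "?V y \<le> 9 ^ Suc ?N * ?V x" if "y \<in> cball x 2" for x y
    using that c by (intro weight_shift) (auto simp: dist_norm norm_minus_commute)
  define C1 where "C1 = K * (C0 * 9 ^ Suc ?N)"
  have C1: "C1 > 0" using K0 C0 by (simp add: C1_def)
  have d1: "\<bar>d b x\<bar> \<le> C1 * ?V x" if b: "b \<in> Basis" for b x
  proof -
    have "\<bar>d b x\<bar> \<le> K * (C0 * (9 ^ Suc ?N * ?V x))"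
    proof (rule d_le[OF b])
      fix y assume "y \<in> cball x 1"
      then have "C0 * ?V y \<le> C0 * (9 ^ Suc ?N * ?V x)"
        using C0 shiftV[of y x] by (intro mult_left_mono) auto
      then show "u y \<le> C0 * (9 ^ Suc ?N * ?V x)" using u0[of y] by linarith
    qed
    then show ?thesis by (simp add: C1_def mult_ac)
  qed
  define C2 where "C2 = K * (C1 * 9 ^ Suc ?N)"
  have C2: "C2 > 0" using K0 C1 by (simp add: C2_def)
  have dd1: "\<bar>dd e b x\<bar> \<le> C2 * ?V x" if be: "b \<in> Basis" "e \<in> Basis" for b e x
  proof -
    have "\<bar>dd e b x\<bar> \<le> K * (C1 * (9 ^ Suc ?N * ?V x))"
    proof (rule dd_le[OF be])
      fix y assume "y \<in> cball x 2"
      then have "C1 * ?V y \<le> C1 * (9 ^ Suc ?N * ?V x)"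
        using C1 shiftV[of y x] by (intro mult_left_mono) auto
      then show "\<bar>d e y\<bar> \<le> C1 * (9 ^ Suc ?N * ?V x)" using d1[OF be(2), of y] by linarith
    qed
    then show ?thesis by (simp add: C2_def mult_ac)
  qed
  define C where "C = C0 + C1 + C2 + L * C0"
  have LC: "L * C0 > 0" using L0 C0 by simp
  have C: "C > 0" "C0 \<le> C" "C1 \<le> C" "C2 \<le> C" "L * C0 \<le> C"
    using C0 C1 C2 LC by (auto simp: C_def)
  have up: "\<bar>a\<bar> \<le> C * ?V x" if "\<bar>a\<bar> \<le> B * ?V x" "B \<le> C" for a B x
    using that mult_right_mono[of B C "?V x"] V0[of x] by linarith
  have bu: "\<bar>u x\<bar> \<le> C * ?V x" for x
    using up[of "u x" C0 x] u0[of x] pos[of x] C by simp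
  have bg: "\<bar>u x - u x powr p\<bar> \<le> C * ?V x" for x
  proof (rule up[OF _ C(5)])
    have "\<bar>u x - u x powr p\<bar> \<le> L * u x" using nonlinearity_le pos le_m by blast
    also have "\<dots> \<le> L * (C0 * ?V x)" using u0 L0 by (intro mult_left_mono) auto
    finally show "\<bar>u x - u x powr p\<bar> \<le> L * C0 * ?V x" by simp
  qed
  have bd: "\<bar>d b x\<bar> \<le> C * ?V x" if "b \<in> Basis" for b x using up[OF d1[OF that] C(3)] .
  have bdd: "\<bar>dd e b x\<bar> \<le> C * ?V x" if "b \<in> Basis" "e \<in> Basis" for b e x using up[OF dd1[OF that] C(4)] .
  \<comment> \<open>For a product of two quantities bounded by \<open>C * ?V x\<close>, one factor
    \<open>?V x\<close> is bounded by 1 and the other, with or without a coordinate, by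
    \<open>?W x / c\<close>.\<close>
  define D where "D = C\<^sup>2 / c"
  have D: "D > 0" using C c by (simp add: D_def)
  have S1: "1 + c * (x \<bullet> x) \<ge> 1" for x :: 'a using c by simp
  have VW: "?V x = ?W x / (1 + c * (x \<bullet> x))" for x by (simp add: weight_def)
  have V1: "?V x \<le> 1" for x
    using one_le_power[OF S1[of x], of "Suc ?N"] S1[of x] by (simp add: weight_def del: power_Suc)
  have xV: "\<bar>x \<bullet> i\<bar> * ?V x \<le> ?W x / c" "?V x \<le> ?W x / c" if i: "i \<in> Basis" for x i
  proof -
    have frac: "a / s \<le> b / r" if "0 < s" "0 < r" "a * r \<le> b * s" for a b r s :: real
      using that by (simp add: divide_simps)
    have Sp: "0 < 1 + c * (x \<bullet> x)" using S1[of x] by linarith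
    have "\<bar>x \<bullet> i\<bar>\<^sup>2 \<le> x \<bullet> x"
      using Basis_le_norm[OF i, of x] power_mono[of "\<bar>x \<bullet> i\<bar>" "norm x" 2] by (simp add: power2_norm_eq_inner)
    then have "\<bar>x \<bullet> i\<bar> \<le> 1 + x \<bullet> x"
      using zero_le_power2[of "\<bar>x \<bullet> i\<bar> - 1"] by (simp add: power2_eq_square algebra_simps)
    then have "c * \<bar>x \<bullet> i\<bar> \<le> c * (1 + x \<bullet> x)" using c by (intro mult_left_mono) auto
    also have "\<dots> \<le> 1 + c * (x \<bullet> x)" using c by (simp add: algebra_simps)
    finally have "(c * \<bar>x \<bullet> i\<bar>) * ?W x \<le> (1 + c * (x \<bullet> x)) * ?W x"
      using W0[of x] by (intro mult_right_mono) auto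
    then show "\<bar>x \<bullet> i\<bar> * ?V x \<le> ?W x / c"
      unfolding VW times_divide_eq_right using Sp c by (intro frac) (simp_all add: mult_ac)
    have "c \<le> 1 + c * (x \<bullet> x)" using c S1[of x] by linarith
    then have "c * ?W x \<le> (1 + c * (x \<bullet> x)) * ?W x"
      using W0[of x] by (intro mult_right_mono) auto
    then show "?V x \<le> ?W x / c"
      unfolding VW using Sp c by (intro frac) (simp_all add: mult.commute)
  qed
  have pr: "\<bar>a * b\<bar> \<le> D * ?W x" "\<bar>(x \<bullet> i) * (a * b)\<bar> \<le> D * ?W x"
    if ab: "\<bar>a\<bar> \<le> C * ?V x" "\<bar>b\<bar> \<le> C * ?V x" and i: "i \<in> Basis" for a b x i
  proof -
    have "\<bar>a\<bar> * \<bar>b\<bar> \<le> (C * ?V x) * (C * ?V x)"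
      using ab C V0[of x] by (intro mult_mono) auto
    also have "\<dots> = C\<^sup>2 * ?V x * ?V x" by (simp add: power2_eq_square)
    also have "\<dots> \<le> C\<^sup>2 * ?V x * 1" using V0[of x] V1[of x] by (intro mult_left_mono) auto
    finally have *: "\<bar>a * b\<bar> \<le> C\<^sup>2 * ?V x" by (simp add: abs_mult)
    have "C\<^sup>2 * ?V x \<le> C\<^sup>2 * (?W x / c)" using xV(2)[OF i] by (intro mult_left_mono) auto
    then show "\<bar>a * b\<bar> \<le> D * ?W x" using * by (simp add: D_def)
    have "\<bar>(x \<bullet> i) * (a * b)\<bar> \<le> \<bar>x \<bullet> i\<bar> * (C\<^sup>2 * ?V x)"
      using * unfolding abs_mult[of "x \<bullet> i"] by (intro mult_left_mono) auto
    also have "\<dots> = C\<^sup>2 * (\<bar>x \<bullet> i\<bar> * ?V x)" by simp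
    also have "\<dots> \<le> C\<^sup>2 * (?W x / c)" using xV(1)[OF i] by (intro mult_left_mono) auto
    finally show "\<bar>(x \<bullet> i) * (a * b)\<bar> \<le> D * ?W x" by (simp add: D_def)
  qed
  have sum_le: "\<bar>\<Sum>i\<in>Basis. g i\<bar> \<le> ?N * B" if "\<And>i. i \<in> Basis \<Longrightarrow> \<bar>g i\<bar> \<le> B" for g :: "'a \<Rightarrow> real" and B :: real
    using order.trans[OF sum_abs sum_bounded_above[of Basis "\<lambda>i. \<bar>g i\<bar>" B]] that by simp
  \<comment> \<open>A generous total: the three groups in \<open>pohozaev_field'\<close> cost
    \<open>3 * ?N\<close>, \<open>?N + 1\<close> and \<open>?N + 1\<close> times
    \<open>D * ?W x\<close>.\<close>
  define M where "M = (5 * ?N + 5) * D"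
  have Fb: "\<bar>F (u x)\<bar> \<le> D * ?W x" "\<bar>(x \<bullet> i) * F (u x)\<bar> \<le> D * ?W x" if i: "i \<in> Basis" for x i
  proof -
    have *: "\<bar>F (u x)\<bar> \<le> \<bar>u x * u x\<bar>"
      using F_pos[OF pos le_m, of x] F_bounds(2)[OF pos le_m, of x] by (simp add: power2_eq_square)
    then show "\<bar>F (u x)\<bar> \<le> D * ?W x" using pr(1)[OF bu bu i] by (rule order.trans)
    have "\<bar>(x \<bullet> i) * F (u x)\<bar> \<le> \<bar>(x \<bullet> i) * (u x * u x)\<bar>"
      using * unfolding abs_mult[of "x \<bullet> i"] by (intro mult_left_mono) auto
    then show "\<bar>(x \<bullet> i) * F (u x)\<bar> \<le> D * ?W x" using pr(2)[OF bu bu i] by (rule order.trans)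
  qed
  have bE: "\<bar>energy x\<bar> \<le> (?N + 1) * (D * ?W x)" "\<bar>(x \<bullet> j) * energy x\<bar> \<le> (?N + 1) * (D * ?W x)"
    if j: "j \<in> Basis" for x j
  proof -
    have "\<bar>\<Sum>i\<in>Basis. d i x * d i x\<bar> \<le> ?N * (D * ?W x)"
      by (rule sum_le) (use pr(1)[OF bd bd] in blast)
    then show "\<bar>energy x\<bar> \<le> (?N + 1) * (D * ?W x)"
      unfolding energy_def using Fb(1)[OF j, of x] by (simp add: algebra_simps abs_le_iff)
    have "\<bar>\<Sum>i\<in>Basis. (x \<bullet> j) * (d i x * d i x)\<bar> \<le> ?N * (D * ?W x)"
      by (rule sum_le) (use pr(2)[OF bd bd j] in blast)
    moreover have "(x \<bullet> j) * energy x = (\<Sum>i\<in>Basis. (x \<bullet> j) * (d i x * d i x)) / 2 + (x \<bullet> j) * F (u x)"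
      by (simp add: energy_def sum_distrib_left algebra_simps)
    ultimately show "\<bar>(x \<bullet> j) * energy x\<bar> \<le> (?N + 1) * (D * ?W x)"
      using Fb(2)[OF j, of x] by (simp add: algebra_simps abs_le_iff)
  qed
  have bX: "\<bar>pohozaev_field j x\<bar> \<le> M * ?W x" if j: "j \<in> Basis" for j x
  proof -
    have "\<bar>\<Sum>i\<in>Basis. (x \<bullet> i) * (d i x * d j x)\<bar> \<le> ?N * (D * ?W x)"
      by (rule sum_le) (use pr(2)[OF bd bd[OF j]] in blast)
    moreover have "0 \<le> D * ?W x" "0 \<le> ?N * (D * ?W x)" using D W0[of x] by auto
    ultimately show ?thesis
      unfolding pohozaev_field_def M_def using bE(2)[OF j, of x] by (simp add: algebra_simps abs_le_iff)
  qed
  have bX': "\<bar>pohozaev_field' j x\<bar> \<le> M * ?W x" if j: "j \<in> Basis" for j x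
  proof -
    have "\<bar>\<Sum>i\<in>Basis. (j \<bullet> i) * (d i x * d j x) + (x \<bullet> i) * (dd j i x * d j x + d i x * dd j j x)\<bar>
        \<le> ?N * (3 * (D * ?W x))"
    proof (rule sum_le)
      fix i :: 'a assume i: "i \<in> Basis"
      have "\<bar>(j \<bullet> i) * (d i x * d j x)\<bar> \<le> \<bar>d i x * d j x\<bar>"
        using i j by (auto simp: inner_Basis)
      moreover note pr(1)[OF bd[OF i] bd[OF j] j, of x]
        pr(2)[OF bdd[OF i j] bd[OF j] i, of x] pr(2)[OF bd[OF i] bdd[OF j j] i, of x]
      ultimately show "\<bar>(j \<bullet> i) * (d i x * d j x) + (x \<bullet> i) * (dd j i x * d j x + d i x * dd j j x)\<bar>
        \<le> 3 * (D * ?W x)"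
        unfolding distrib_left by linarith
    qed
    moreover have "\<bar>(x \<bullet> j) * ((\<Sum>i\<in>Basis. d i x * dd j i x) + (u x - u x powr p) * d j x)\<bar>
        \<le> (?N + 1) * (D * ?W x)"
    proof -
      have "\<bar>\<Sum>i\<in>Basis. (x \<bullet> j) * (d i x * dd j i x)\<bar> \<le> ?N * (D * ?W x)"
        by (rule sum_le) (use pr(2)[OF bd bdd[OF _ j] j] in blast)
      then show ?thesis using pr(2)[OF bg bd[OF j] j, of x]
        unfolding distrib_left sum_distrib_left by (simp add: algebra_simps abs_le_iff)
    qed
    moreover have "0 \<le> D * ?W x" using D W0[of x] by auto
    ultimately show ?thesis
      unfolding pohozaev_field'_def M_def using bE(1)[OF j, of x] by (simp add: algebra_simps abs_le_iff)
  qed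
  have M: "M > 0" using D by (simp add: M_def add_nonneg_pos)
  \<comment> \<open>The factor \<open>9 ^ ?N\<close> makes \<open>Z x\<close> dominate at all
    translates of \<open>x\<close> by at most 2, as the vanishing-integral lemma requires along unit
    segments.\<close>
  define Z where "Z x = M * 9 ^ ?N * ?W x" for x
  have MZ: "M * ?W y \<le> Z x" if "norm (y - x) \<le> 2" for x y
    using weight_shift[of c y x ?N] that c M by (simp add: Z_def mult.assoc)
  have iZ: "integrable lborel Z"
    unfolding Z_def using integrable_weight[OF c(1), where 'a = 'a] by simp
  have meas: "pohozaev_field j \<in> borel_measurable borel" "pohozaev_field' j \<in> borel_measurable borel"
    if "j \<in> Basis" for j
    using continuous_pohozaev[OF that] by (auto intro: borel_measurable_continuous_onI)
  have int': "integrable lborel (pohozaev_field' j)" if j: "j \<in> Basis" for j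
  proof (rule Bochner_Integration.integrable_bound[OF iZ])
    show "AE x in lborel. norm (pohozaev_field' j x) \<le> norm (Z x)"
    proof (rule AE_I2)
      fix x show "norm (pohozaev_field' j x) \<le> norm (Z x)"
        using bX'[OF j, of x] MZ[of x x] by simp
    qed
  qed (use meas j in auto)
  have zero: "(\<integral>x. pohozaev_field' j x \<partial>lborel) = 0" if j: "j \<in> Basis" for j
  proof (rule integral_dir_deriv_eq_0[OF dir_deriv_pohozaev_field[OF j] iZ meas[OF j]])
    show "\<bar>pohozaev_field j x\<bar> \<le> Z x" for x using bX[OF j, of x] MZ[of x x] by simp
    show "\<bar>pohozaev_field' j (x + t *\<^sub>R j)\<bar> \<le> Z x" if "\<bar>t\<bar> \<le> 1" for x t
      using bX'[OF j, of "x + t *\<^sub>R j"] MZ[of "x + t *\<^sub>R j" x] that j by simp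
  qed
  define P where "P x = - (\<Sum>j\<in>Basis. pohozaev_field' j x)" for x
  have P0: "0 < P x" for x
  proof -
    \<comment> \<open>Dimension at least 2 gives the gradient term the same sign as the potential
      term.\<close>
    have "0 \<le> (?N / 2 - 1) * (\<Sum>i\<in>Basis. d i x * d i x)"
      using dim by (intro mult_nonneg_nonneg[OF _ sum_nonneg]) auto
    moreover have "0 < ?N * F (u x)" using F_pos[OF pos le_m] by simp
    ultimately show ?thesis unfolding P_def pohozaev_divergence by linarith
  qed
  have "integrable lborel P" unfolding P_def using int' by auto
  moreover have "(\<integral>x. P x \<partial>lborel) = 0"
    unfolding P_def using int' zero by (simp add: Bochner_Integration.integral_sum)
  ultimately have "AE x in lborel. P x = 0"
    using P0 by (subst (asm) integral_nonneg_eq_0_iff_AE) (auto simp: less_imp_le)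
  then have "AE x in (lborel :: 'a measure). False"
    by eventually_elim (metis P0 less_irrefl)
  then show False by (simp add: eventually_False ae_filter_eq_bot_iff)
qed

end

section \<open>Vanishing at infinity\<close>

text \<open>Both sides differentiate the same function of one variable. This links the hypothesis on
  \<open>gradient_fst\<close>, which is defined by slices, to the partial derivatives of
  \<open>u\<close> on the full space.\<close>

lemma partial_deriv_fst:
  fixes u :: "'b::euclidean_space \<times> real \<Rightarrow> real"
  assumes u: "\<And>z. u differentiable (at z)"
  shows "partial_deriv b (\<lambda>y. u (y, t)) x = partial_deriv (b, 0) u (x, t)"
proof -
  have "(\<lambda>y. u (y, t)) differentiable (at y)" for y
    using differentiable_chain_at[of "\<lambda>y. (y, t)" y u] u by (simp add: o_def)
  then have "has_dir_deriv b (\<lambda>y. u (y, t)) (partial_deriv b (\<lambda>y. u (y, t)))"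
    by (rule has_dir_deriv_partial)
  then have 1: "((\<lambda>s. u (x + s *\<^sub>R b, t)) has_real_derivative partial_deriv b (\<lambda>y. u (y, t)) x) (at 0)"
    unfolding has_dir_deriv_def by blast
  have "has_dir_deriv (b, 0) u (partial_deriv (b, 0) u)"
    by (rule has_dir_deriv_partial[OF u])
  then have "((\<lambda>s. u ((x, t) + s *\<^sub>R (b, 0))) has_real_derivative partial_deriv (b, 0) u (x, t)) (at 0)"
    unfolding has_dir_deriv_def by blast
  then have 2: "((\<lambda>s. u (x + s *\<^sub>R b, t)) has_real_derivative partial_deriv (b, 0) u (x, t)) (at 0)"
    by simp
  show ?thesis by (rule DERIV_unique[OF 1 2])
qed

lemma abs_partial_deriv_fst_le:
  fixes u :: "'b::euclidean_space \<times> real \<Rightarrow> real"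
  assumes u: "\<And>z. u differentiable (at z)" and b: "b \<in> Basis"
  shows "\<bar>partial_deriv (b, 0) u (x, t)\<bar> \<le> norm (gradient_fst u (x, t))"
proof -
  have "gradient_fst u (x, t) \<bullet> b = partial_deriv (b, 0) u (x, t)"
    using b by (simp add: gradient_fst_def gradient_def inner_sum_left_Basis partial_deriv_fst[OF u])
  then show ?thesis using Basis_le_norm[OF b, of "gradient_fst u (x, t)"] by simp
qed

lemma sum_Basis_prod_real:
  "(\<Sum>z\<in>(Basis :: ('b::euclidean_space \<times> real) set). f z) = (\<Sum>b\<in>Basis. f (b, 0)) + f (0, 1)"
proof -
  have "inj_on (\<lambda>b. (b :: 'b, 0 :: real)) Basis" by (auto intro!: inj_onI)
  then show ?thesis
    unfolding Basis_prod_def by (subst sum.union_disjoint) (auto simp: sum.reindex)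
qed

text \<open>Far out in \<open>x'\<close>, the Hamiltonian \<open>u\<^sub>N\<^sup>2 / 2 - F(u)\<close> is almost conserved along vertical lines
  because the Laplacian in \<open>x'\<close> is small, hence it is almost \<open>0\<close>; at the top of each line this forces \<open>F(u)\<close> to be small.\<close>

lemma solution_vanishes_at_infinity:
  fixes u :: "'b::euclidean_space \<times> real \<Rightarrow> real"
  assumes sol: "bounded_solution u p m"
    and unif: "uniform_limit UNIV (\<lambda>t x. u (x, t)) (\<lambda>x. 0) at_infinity"
    and grad: "\<And>t. ((\<lambda>x. gradient_fst u (x, t)) \<longlongrightarrow> 0) at_infinity"
  shows "(u \<longlongrightarrow> 0) at_infinity"
proof -
  interpret bounded_solution u p m by fact
  let ?e = "(0, 1) :: 'b \<times> real"
  have e: "?e \<in> Basis" by (auto simp: Basis_prod_def)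
  have b0: "(b, 0) \<in> (Basis :: ('b \<times> real) set)" if "b \<in> Basis" for b
    using that by (auto simp: Basis_prod_def)
  have K0: "K > 0" using K_ge_1 by linarith
  have dm: "\<bar>d b z\<bar> \<le> K * m" if "b \<in> Basis" for b z
    using d_le[OF that] le_m by blast
  have line: "((\<lambda>s. f (x, s)) has_real_derivative f' (x, t)) (at t)" if "has_dir_deriv ?e f f'" for f f' x t
    using has_dir_derivD[OF that, of "(x, 0)" t] by simp
  have decay: "\<exists>T. \<forall>x t. T \<le> \<bar>t\<bar> \<longrightarrow> u (x, t) < \<sigma>" if "\<sigma> > 0" for \<sigma>
  proof -
    have "\<forall>\<^sub>F t in at_infinity. \<forall>x\<in>UNIV. dist (u (x, t)) 0 < \<sigma>"
      by (rule uniform_limitD[OF unif that])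
    then show ?thesis unfolding eventually_at_infinity by (auto simp: abs_less_iff)
  qed
  \<comment> \<open>Uniformity in \<open>t\<close> on a bounded segment: the hypothesis is used at
    the finitely many heights of a net with tolerance \<open>\<eta> / 2\<close>, and the Lipschitz
    bound \<open>K2\<close> in \<open>t\<close> covers the rest.\<close>
  have small_d: "\<exists>R. \<forall>x t. R \<le> norm x \<longrightarrow> \<bar>t\<bar> \<le> T \<longrightarrow> \<bar>d (b, 0) (x, t)\<bar> \<le> \<eta>"
    if b: "b \<in> Basis" and eta: "\<eta> > 0" for b T \<eta>
  proof -
    define K2 where "K2 = K * (K * m)"
    have K2: "K2 > 0" using K0 m_pos by (simp add: K2_def)
    have lip: "\<bar>d (b, 0) (x, t) - d (b, 0) (x, s)\<bar> \<le> K2 * \<bar>t - s\<bar>" for x t s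
    proof -
      have "\<bar>d (b, 0) ((x, s) + (t - s) *\<^sub>R ?e) - d (b, 0) (x, s)\<bar> \<le> K2 * \<bar>t - s\<bar>"
        unfolding K2_def
        by (rule has_dir_deriv_mvt[OF dir_deriv_d[OF b0[OF b]]], rule dd_le[OF b0[OF b] e], rule dm[OF e])
      then show ?thesis by simp
    qed
    define \<delta> where "\<delta> = \<eta> / (2 * K2)"
    have "\<delta> > 0" using eta K2 by (simp add: \<delta>_def)
    then obtain k where k: "finite k" "{-T..T} \<subseteq> (\<Union>s\<in>k. ball s \<delta>)"
      using compact_Icc[of "-T" T] unfolding compact_eq_totally_bounded by blast
    have "\<forall>\<^sub>F x in at_infinity. \<bar>d (b, 0) (x, s)\<bar> < \<eta> / 2" for s
    proof -
      have "\<forall>\<^sub>F x in at_infinity. dist (gradient_fst u (x, s)) 0 < \<eta> / 2"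
        by (rule tendstoD[OF grad]) (use eta in simp)
      then show ?thesis
      proof eventually_elim
        case (elim x)
        then show ?case using abs_partial_deriv_fst_le[OF differentiable(1) b, of x s] by simp
      qed
    qed
    then have "\<forall>\<^sub>F x in at_infinity. \<forall>s\<in>k. \<bar>d (b, 0) (x, s)\<bar> < \<eta> / 2"
      using k(1) by (simp add: eventually_ball_finite)
    then obtain R where R: "\<And>x s. R \<le> norm x \<Longrightarrow> s \<in> k \<Longrightarrow> \<bar>d (b, 0) (x, s)\<bar> < \<eta> / 2"
      unfolding eventually_at_infinity by blast
    have "\<bar>d (b, 0) (x, t)\<bar> \<le> \<eta>" if x: "R \<le> norm x" and t: "\<bar>t\<bar> \<le> T" for x t
    proof -
      have "t \<in> {-T..T}" using t by auto
      then have "t \<in> (\<Union>s\<in>k. ball s \<delta>)" using k(2) by blast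
      then obtain s where s: "s \<in> k" "dist s t < \<delta>" by auto
      have "K2 * \<bar>t - s\<bar> \<le> K2 * \<delta>"
        using s K2 by (intro mult_left_mono) (auto simp: dist_real_def)
      also have "\<dots> = \<eta> / 2" using K2 by (simp add: \<delta>_def)
      finally show ?thesis using lip[of x t s] R[OF x s(1)] by linarith
    qed
    then show ?thesis by blast
  qed
  have small_dd: "\<exists>R. \<forall>x t. R \<le> norm x \<longrightarrow> \<bar>t\<bar> \<le> T \<longrightarrow> \<bar>\<Sum>b\<in>Basis. dd (b, 0) (b, 0) (x, t)\<bar> \<le> \<eta>"
    if eta: "\<eta> > 0" for T \<eta>
  proof -
    \<comment> \<open>Compensates the factor \<open>K\<close> lost in \<open>dd_le\<close> and the
      \<open>DIM('b)\<close> summands. The enlargements by 2 of \<open>T\<close> and of the radius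
      below make room for the ball in \<open>dd_le\<close>.\<close>
    define \<eta>' where "\<eta>' = \<eta> / (K * DIM('b))"
    have eta': "\<eta>' > 0" using eta K0 by (simp add: \<eta>'_def)
    have "\<forall>b\<in>Basis. \<exists>R. \<forall>x t. R \<le> norm x \<longrightarrow> \<bar>t\<bar> \<le> T + 2 \<longrightarrow> \<bar>d (b, 0) (x, t)\<bar> \<le> \<eta>'"
      using small_d eta' by blast
    then obtain R where R: "\<And>b x t. b \<in> Basis \<Longrightarrow> R b \<le> norm x \<Longrightarrow> \<bar>t\<bar> \<le> T + 2 \<Longrightarrow> \<bar>d (b, 0) (x, t)\<bar> \<le> \<eta>'"
      by metis
    have "\<bar>\<Sum>b\<in>Basis. dd (b, 0) (b, 0) (x, t)\<bar> \<le> \<eta>" if x: "Max (R ` Basis) + 2 \<le> norm x" and t: "\<bar>t\<bar> \<le> T" for x t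
    proof -
      have "\<bar>dd (b, 0) (b, 0) (x, t)\<bar> \<le> K * \<eta>'" if b: "b \<in> Basis" for b
      proof (rule dd_le[OF b0[OF b] b0[OF b]])
        fix z :: "'b \<times> real" assume z: "z \<in> cball (x, t) 2"
        obtain y s where ys: "z = (y, s)" by (cases z)
        have "dist x y \<le> 2" "dist t s \<le> 2"
          using z dist_fst_le[of "(x, t)" z] dist_snd_le[of "(x, t)" z] by (auto simp: ys)
        moreover have "norm x \<le> norm y + dist x y"
          using norm_triangle_ineq2[of x y] by (simp add: dist_norm)
        moreover have "R b \<le> Max (R ` Basis)" using b by simp
        ultimately show "\<bar>d (b, 0) z\<bar> \<le> \<eta>'"
          unfolding ys using x t by (intro R b) (auto simp: dist_real_def)
      qed
      then have "\<bar>\<Sum>b\<in>(Basis :: 'b set). dd (b, 0) (b, 0) (x, t)\<bar> \<le> DIM('b) * (K * \<eta>')"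
        using order.trans[OF sum_abs sum_bounded_above[of Basis "\<lambda>b. \<bar>dd (b, 0) (b, 0) (x, t)\<bar>" "K * \<eta>'"]] by simp
      also have "\<dots> = \<eta>" using K0 by (simp add: \<eta>'_def)
      finally show ?thesis .
    qed
    then show ?thesis by blast
  qed
  define h where "h x t = (d ?e (x, t))\<^sup>2 / 2 - F (u (x, t))" for x t
  \<comment> \<open>The equation replaces the vertical second derivative, so that only the Laplacian
    in x' survives as the defect of conservation.\<close>
  have h_deriv: "((\<lambda>s. h x s) has_real_derivative - (d ?e (x, t) * (\<Sum>b\<in>Basis. dd (b, 0) (b, 0) (x, t)))) (at t)" for x t
  proof -
    have du: "((\<lambda>s. u (x, s)) has_real_derivative d ?e (x, t)) (at t)" by (rule line[OF dir_deriv_u])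
    have ddu: "((\<lambda>s. d ?e (x, s)) has_real_derivative dd ?e ?e (x, t)) (at t)" by (rule line[OF dir_deriv_d[OF e]])
    have Fu: "((\<lambda>s. F (u (x, s))) has_real_derivative (u (x, t) - u (x, t) powr p) * d ?e (x, t)) (at t)"
      using DERIV_chain2[OF F_deriv du] pos by simp
    have "(\<Sum>b\<in>Basis. dd (b, 0) (b, 0) (x, t)) + dd ?e ?e (x, t) = u (x, t) - u (x, t) powr p"
      using laplacian_eq[of "(x, t)"] by (simp add: sum_Basis_prod_real)
    then have eq: "(\<Sum>b\<in>Basis. dd (b, 0) (b, 0) (x, t)) = u (x, t) - u (x, t) powr p - dd ?e ?e (x, t)" by linarith
    from DERIV_diff[OF DERIV_cdivide[OF DERIV_power[OF ddu, of 2], of 2] Fu]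
    show ?thesis unfolding h_def eq by (rule DERIV_cong) (simp add: algebra_simps)
  qed
  define \<kappa> where "\<kappa> = 1 / 2 - m powr (p - 1) / (p + 1)"
  have kap: "\<kappa> > 0" using F_coeff_pos by (simp add: \<kappa>_def)
  have horizontal: "\<exists>R. \<forall>x t. R \<le> norm x \<longrightarrow> \<kappa> * (u (x, t))\<^sup>2 \<le> \<epsilon>" if eps: "\<epsilon> > 0" for \<epsilon>
  proof -
    define Q where "Q = K\<^sup>2 + 1"
    have KK: "Q > 0" by (simp add: Q_def add_nonneg_pos)
    \<comment> \<open>Where \<open>u\<close> is below \<open>\<sigma>\<close> on a unit ball,
      \<open>h\<close> is at most \<open>Q * \<sigma>\<^sup>2\<close> in absolute value; the cap 1
      allows \<open>\<sigma>\<^sup>2 \<le> \<sigma>\<close>.\<close>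
    define \<sigma> where "\<sigma> = min 1 (\<epsilon> / (2 * Q))"
    have sig: "0 < \<sigma>" "\<sigma> \<le> 1" "\<sigma> \<le> \<epsilon> / (2 * Q)" using eps KK by (auto simp: \<sigma>_def)
    have "\<sigma>\<^sup>2 \<le> \<sigma>" using sig by (simp add: power2_eq_square mult_left_le)
    then have "Q * \<sigma>\<^sup>2 \<le> Q * (\<epsilon> / (2 * Q))"
      using sig KK by (intro mult_left_mono) auto
    also have "\<dots> = \<epsilon> / 2" using KK by simp
    finally have sig2: "Q * \<sigma>\<^sup>2 \<le> \<epsilon> / 2" .
    obtain T0 where T0: "\<And>x t. T0 \<le> \<bar>t\<bar> \<Longrightarrow> u (x, t) < \<sigma>" using decay[OF sig(1)] by blast
    \<comment> \<open>The extra unit keeps the ball of radius 1 used by \<open>d_le\<close> inside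
      the region \<open>T0 \<le> \<bar>t\<bar>\<close>.\<close>
    define T where "T = max T0 0 + 1"
    have T: "T > 0" by (simp add: T_def add_nonneg_pos)
    have ends: "\<bar>h x t\<bar> \<le> \<epsilon> / 2" if t: "T \<le> \<bar>t\<bar>" for x t
    proof -
      have "\<bar>d ?e (x, t)\<bar> \<le> K * \<sigma>"
      proof (rule d_le[OF e])
        fix z :: "'b \<times> real" assume z: "z \<in> cball (x, t) 1"
        obtain y s where ys: "z = (y, s)" by (cases z)
        have "dist t s \<le> 1" using z dist_snd_le[of "(x, t)" z] by (auto simp: ys)
        then have "T0 \<le> \<bar>s\<bar>" using t by (auto simp: T_def dist_real_def)
        then show "u z \<le> \<sigma>" using T0 by (simp add: ys less_imp_le)
      qed
      then have "(d ?e (x, t))\<^sup>2 \<le> (K * \<sigma>)\<^sup>2"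
        using power_mono[of "\<bar>d ?e (x, t)\<bar>" "K * \<sigma>" 2] by simp
      moreover have "T0 \<le> \<bar>t\<bar>" using t by (auto simp: T_def)
      then have "(u (x, t))\<^sup>2 \<le> \<sigma>\<^sup>2"
        using T0[of t x] pos[of "(x, t)"] by (intro power_mono) auto
      moreover have "0 < F (u (x, t))" "F (u (x, t)) \<le> (u (x, t))\<^sup>2"
        using F_pos[OF pos le_m] F_bounds(2)[OF pos le_m] by auto
      moreover have "0 \<le> (d ?e (x, t))\<^sup>2" by simp
      ultimately show ?thesis using sig2 unfolding h_def Q_def power_mult_distrib distrib_right by linarith
    qed
    \<comment> \<open>Over a length of at most \<open>2 * T\<close>, with vertical derivative at
      most \<open>K * m\<close>, the Hamiltonian then drifts by at most
      \<open>\<epsilon> / 2\<close>.\<close>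
    define \<eta> where "\<eta> = \<epsilon> / (4 * T * (K * m))"
    have eta: "\<eta> > 0" using eps T K0 m_pos by (simp add: \<eta>_def)
    obtain R where R: "\<And>x t. R \<le> norm x \<Longrightarrow> \<bar>t\<bar> \<le> T \<Longrightarrow> \<bar>\<Sum>b\<in>Basis. dd (b, 0) (b, 0) (x, t)\<bar> \<le> \<eta>"
      using small_dd[OF eta] by blast
    have h_le: "\<bar>h x t\<bar> \<le> \<epsilon>" if x: "R \<le> norm x" for x t
    proof (cases "T \<le> \<bar>t\<bar>")
      case True
      then show ?thesis using ends[of t x] eps by simp
    next
      case False
      have "norm (h x t - h x T) \<le> (K * m * \<eta>) * norm (t - T)"
      proof (rule field_differentiable_bound[of "{-T..T}"])
        fix s assume s: "s \<in> {-T..T}"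
        show "((\<lambda>s. h x s) has_field_derivative - (d ?e (x, s) * (\<Sum>b\<in>Basis. dd (b, 0) (b, 0) (x, s)))) (at s within {-T..T})"
          by (rule has_field_derivative_at_within[OF h_deriv])
        show "norm (- (d ?e (x, s) * (\<Sum>b\<in>Basis. dd (b, 0) (b, 0) (x, s)))) \<le> K * m * \<eta>"
          unfolding real_norm_def abs_minus_cancel abs_mult
          using dm[OF e, of "(x, s)"] R[OF x, of s] s eta K0 m_pos by (intro mult_mono) (auto simp: abs_le_iff)
      qed (use False T in auto)
      also have "\<dots> \<le> (K * m * \<eta>) * (2 * T)"
        using False eta K0 m_pos by (intro mult_left_mono) (auto simp: abs_le_iff)
      also have "\<dots> = \<epsilon> / 2" using T K0 m_pos by (simp add: \<eta>_def field_simps)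
      finally have "\<bar>h x t - h x T\<bar> \<le> \<epsilon> / 2" by simp
      moreover have "\<bar>h x T\<bar> \<le> \<epsilon> / 2" using ends[of T x] by simp
      ultimately show ?thesis by linarith
    qed
    have "\<kappa> * (u (x, t))\<^sup>2 \<le> \<epsilon>" if x: "R \<le> norm x" for x t
    proof -
      obtain T1 where T1: "\<And>t. T1 \<le> \<bar>t\<bar> \<Longrightarrow> u (x, t) < u (x, 0)" using decay[OF pos] by blast
      then have "\<forall>\<^sub>F t in at_infinity. u (x, t) < u (x, 0)" unfolding eventually_at_infinity by auto
      moreover have "continuous_on UNIV (\<lambda>t. u (x, t))"
        by (intro continuous_on_compose2[OF continuous_u] continuous_intros) auto
      ultimately obtain t0 where t0: "\<And>t. u (x, t) \<le> u (x, t0)"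
        using attains_sup_if_eventually_less[of "\<lambda>t. u (x, t)" 0] by blast
      \<comment> \<open>At the top of the line \<open>h\<close> reduces to
        \<open>- F (u (x, t0))\<close>, so smallness of \<open>h\<close> bounds \<open>F\<close> and
        thereby \<open>u\<close> on the whole line.\<close>
      have "d ?e (x, t0) = 0"
        by (rule DERIV_local_max[OF line[OF dir_deriv_u], of 1]) (use t0 in auto)
      then have "F (u (x, t0)) \<le> \<epsilon>" using h_le[OF x, of t0] by (simp add: h_def abs_le_iff)
      moreover have "\<kappa> * (u (x, t0))\<^sup>2 \<le> F (u (x, t0))"
        using F_bounds(1)[OF pos le_m] by (simp add: \<kappa>_def)
      moreover have "\<kappa> * (u (x, t))\<^sup>2 \<le> \<kappa> * (u (x, t0))\<^sup>2"
        using t0[of t] pos[of "(x, t)"] kap by (intro mult_left_mono power_mono) auto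
      ultimately show ?thesis by linarith
    qed
    then show ?thesis by blast
  qed
  show ?thesis
  proof (rule tendstoI)
    fix \<epsilon> :: real assume eps: "\<epsilon> > 0"
    have "\<kappa> * (\<epsilon> / 2)\<^sup>2 > 0" using kap eps by simp
    from horizontal[OF this] obtain R where R: "\<And>x t. R \<le> norm x \<Longrightarrow> \<kappa> * (u (x, t))\<^sup>2 \<le> \<kappa> * (\<epsilon> / 2)\<^sup>2"
      by blast
    obtain T where T: "\<And>x t. T \<le> \<bar>t\<bar> \<Longrightarrow> u (x, t) < \<epsilon>" using decay[OF eps] by blast
    \<comment> \<open>A point this far out has \<open>\<bar>t\<bar> \<ge> T\<close> or
      \<open>norm x \<ge> R\<close>, so one of the two decay statements applies.\<close>
    have "u (x, t) < \<epsilon>" if "R + T \<le> norm (x, t)" for x t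
    proof (cases "T \<le> \<bar>t\<bar>")
      case False
      then have "R \<le> norm x" using that norm_Pair_le[of x t] by simp
      then have "(u (x, t))\<^sup>2 \<le> (\<epsilon> / 2)\<^sup>2" using R[of x t] kap by simp
      then have "u (x, t) \<le> \<epsilon> / 2" by (rule power2_le_imp_le) (use eps in simp)
      then show ?thesis using eps by simp
    qed (rule T)
    then have "\<forall>z. R + T \<le> norm z \<longrightarrow> dist (u z) 0 < \<epsilon>"
      using pos by (auto simp: less_imp_le)
    then show "\<forall>\<^sub>F z in at_infinity. dist (u z) 0 < \<epsilon>" unfolding eventually_at_infinity by blast
  qed
qed

text \<open>The set where \<open>f\<close> exceeds \<open>m\<close> is open, and a nonempty open set
  is not negligible. This turns the essential supremum into a pointwise bound.\<close>

lemma le_if_AE_le: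
  fixes f :: "'a::euclidean_space \<Rightarrow> real"
  assumes cont: "continuous_on UNIV f" and ae: "AE x in lebesgue. f x \<le> m"
  shows "f x \<le> m"
proof (rule ccontr)
  assume "\<not> f x \<le> m"
  have op: "open {x. m < f x}"
    using cont by (intro open_Collect_less continuous_intros)
  then have "{x \<in> space lebesgue. \<not> f x \<le> m} \<in> sets lebesgue" by (simp add: not_le)
  from AE_iff_null[OF this] ae have "negligible {x. m < f x}"
    by (simp add: negligible_iff_null_sets not_le)
  then show False using open_not_negligible[OF op] \<open>\<not> f x \<le> m\<close> by (auto simp: not_le)
qed

theorem proposition5:
  fixes u :: "(real ^ 'm::finite) \<times> real \<Rightarrow> real" and p :: real and N :: nat
  assumes "N = CARD('m) + 1" and "N \<ge> 2"
    and "1 < p" and "N > 3 \<Longrightarrow> p < (real N + 1) / (real N - 3)"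
    and "\<forall>x. 0 < u x" and "bounded (range u)"
    and "classical_solution p u"
    and "uniform_limit UNIV (\<lambda>t x'. u (x', t)) (\<lambda>x'. 0) at_infinity"
    and "\<forall>t. ((\<lambda>x'. gradient_fst u (x', t)) \<longlongrightarrow> 0) at_infinity"
  shows "ereal (((p + 1) / 2) powr (1 / (p - 1))) \<le> Linf_norm u"
proof (rule ccontr)
  let ?M = "((p + 1) / 2) powr (1 / (p - 1))"
  assume "\<not> ereal ?M \<le> Linf_norm u"
  \<comment> \<open>A real number strictly in between is chosen, rather than the norm itself, to
    have a real bound for \<open>u\<close> that is still strictly below the critical height.\<close>
  then obtain m where m: "Linf_norm u < ereal m" "m < ?M"
    using ereal_dense2[of "Linf_norm u" "ereal ?M"] by (auto simp: not_le)
  have "u differentiable (at x)" for x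
    using assms(7) unfolding classical_solution_def C2_def C1_def by blast
  then have cont: "continuous_on UNIV u"
    by (auto simp: continuous_on_eq_continuous_within intro!: differentiable_imp_continuous_within)
  have "AE x in lebesgue. ereal \<bar>u x\<bar> \<le> Linf_norm u"
    unfolding Linf_norm_def by (rule esssup_AE)
  then have "AE x in lebesgue. u x \<le> m"
  proof eventually_elim
    case (elim x)
    then have "ereal \<bar>u x\<bar> < ereal m" using m(1) by (rule le_less_trans)
    then show ?case by simp
  qed
  then have le: "u x \<le> m" for x using le_if_AE_le[OF cont] by blast
  have m0: "0 < m" using le[of 0] assms(5) by (meson less_le_trans)
  have "m powr (p - 1) < ?M powr (p - 1)"
    using m(2) m0 assms(3) by (intro powr_less_mono2) auto
  also have "\<dots> = (p + 1) / 2" using assms(3) by (simp add: powr_powr)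
  finally have sol: "bounded_solution u p m"
    using assms(3,5,7) le by unfold_locales auto
  have "(u \<longlongrightarrow> 0) at_infinity"
    using solution_vanishes_at_infinity[OF sol assms(8)] assms(9) by blast
  moreover have "2 \<le> DIM((real ^ 'm) \<times> real)" using assms(1,2) by simp
  ultimately show False using bounded_solution.not_vanishing[OF sol] by blast
qed

end
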